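(* Consider the game, the pseudo-gradient $F$, the multiplier graph $\mathcal G_\lambda$, Assumptions 1–3, and the inertial iteration described in the context. Suppose Assumptions 1–3 hold. Let $d^*=\max_i d_i$ and let $0<\beta\le\min\{\frac{1}{2d^*},\frac{\eta}{\theta^2}\}$, where $\eta,\theta$ are the constants of Assumption 2. Given a sufficiently small $0<\epsilon<1$, take $\delta>\frac{1}{2\beta}$ and $0<\alpha<1$ such that $$2\beta\delta(1-3\alpha-\epsilon)\ge(1-\alpha)^2 .$$ Suppose that the step-sizes $\tau_i,\nu_i,\sigma_i>0$ satisfy, for every $i=1,\dots,N$, $$\tau_i\le\frac{1}{\max_{j=1,\dots,n_i}\{\sum_{k=1}^m|[A_i^T]_{jk}|\}+\delta},\qquad \nu_i\le\frac{1}{2d_i+\delta},\qquad \sigma_i\le\frac{1}{\max_{j=1,\dots,m}\{\sum_{k=1}^{n_i}|[A_i]_{jk}|\}+2d_i+\delta}.$$ Then, for the sequences generated by the inertial iteration with extrapolation parameter $\alpha$, the players' local strategies converge to the variational GNE $\mathbf x^*=col(x_1^*,\dots,x_N^* )$ of the game, and the local multipliers $\lambda_{i,k}$ of all players converge to the same multiplier $\lambda^*$, where $(\mathbf x^*,\lambda^* )$ satisfies the KKT conditions of $VI(F,X)$; i.e. $$\lim_{k\to\infty}x_{i,k}=x_i^*,\qquad \lim_{k\to\infty}\lambda_{i,k}=\lambda^*,\qquad\forall i=1,\dots,N.$$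
   Context: **Game.** Players $\mathcal N=\{1,\dots,N\}$; player $i$ chooses $x_i\in\mathbf R^{n_i}$; $n=\sum_i n_i$; $\mathbf x=col(x_1,\dots,x_N)\in\mathbf R^n$ (stacked column vector); $\mathbf x_{-i}$ is the stacked vector of all decisions except $x_i$. Player $i$ has an objective $f_i(x_i,\mathbf x_{-i}):\mathbf R^n\to\mathbf R$ and a private set $\Omega_i\subset\mathbf R^{n_i}$. Let $\Omega=\prod_{i=1}^N\Omega_i$, $A=[A_1,\dots,A_N]\in\mathbf R^{m\times n}$ with $A_i\in\mathbf R^{m\times n_i}$, $b=\sum_{i=1}^N b_i\in\mathbf R^m$ with $b_i\in\mathbf R^m$, and $X=\Omega\cap\{\mathbf x\in\mathbf R^n: A\mathbf x\ge b\}$ (componentwise inequality). Player $i$ solves $\min_{x_i} f_i(x_i,\mathbf x_{-i})$ subject to $x_i\in\Omega_i$, $A_ix_i\ge b-\sum_{j\ne i}A_jx_j$. A GNE is a profile $\mathbf x^*$ such that each $x_i^*$ solves player $i$'s problem given $\mathbf x_{-i}^*$. **Pseudo-gradient, variational GNE, KKT.** $F(\mathbf x)=col(\nabla_{x_1}f_1(x_1,\mathbf x_{-1}),\dots,\nabla_{x_N}f_N(x_N,\mathbf x_{-N}))$. $VI(F,X)$: find $\mathbf x^*\in X$ with $\langle F(\mathbf x^* ),\mathbf x-\mathbf x^*\rangle\ge0$ for all $\mathbf x\in X$. A solution of $VI(F,X)$ is called a variational GNE (it is unique under the assumptions below). The KKT conditions of $VI(F,X)$ for $(\mathbf x^*,\lambda^*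 )$, $\lambda^*\in\mathbf R^m$, are $$\mathbf 0\in\nabla_{x_i}f_i(x_i^*,\mathbf x_{-i}^* )-A_i^T\lambda^*+N_{\Omega_i}(x_i^* ),\ i=1,\dots,N,\qquad \mathbf 0\in(A\mathbf x^*-b)+N_{\mathbf R^m_+}(\lambda^* ),$$ where $N_C$ is the normal cone operator of a closed convex set $C$ ($N_C(x)=\emptyset$ for $x\notin C$), and $\mathbf R^m_+$ is the nonnegative orthant. **Multiplier graph.** $\mathcal G_\lambda$ is a graph on $\mathcal N$ with neighbor sets $\mathcal N_i^\lambda$ ($i\notin\mathcal N_i^\lambda$) and weighted adjacency matrix $W=[w_{ij}]$, $w_{ij}>0$ if $j\in\mathcal N_i^\lambda$ and $w_{ij}=0$ otherwise; $d_i=\sum_{j=1}^Nw_{ij}$. **Assumption 1.** For each $i$, $f_i(x_i,\mathbf x_{-i})$ is differentiable and convex in $x_i$ for every fixed $\mathbf x_{-i}$; $\Omega_i$ is closed and convex; $X$ has nonempty interior. **Assumption 2.** For some $\eta,\theta>0$ and all $\mathbf x,\mathbf y\in\Omega$: $\langle F(\mathbf x)-F(\mathbf y),\mathbf x-\mathbf y\rangle\ge\eta\|\mathbf x-\mathbf y\|_2^2$ and $\|F(\mathbf x)-F(\mathbf y)\|_2\le\theta\|\mathbf x-\mathbf y\|_2$. **Assumption 3.** $\mathcal G_\lambda$ is undirected and connected, and $W=W^T$. **Inertial iteration.** Player $i$ has variables $x_{i,k}\in\mathbf R^{n_i}$, $z_{i,k}\in\mathbf R^m$, $\lambda_{i,k}\in\mathbf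 R^m$ and fixed step-sizes $\tau_i,\nu_i,\sigma_i>0$; $\alpha>0$ is a fixed common parameter; $P_C$ denotes Euclidean projection onto $C$. From two arbitrary initial iterates ($k=0,1$), for $k\ge1$: Acceleration phase: $\tilde x_{i,k}=x_{i,k}+\alpha(x_{i,k}-x_{i,k-1})$, $\tilde z_{i,k}=z_{i,k}+\alpha(z_{i,k}-z_{i,k-1})$, $\tilde\lambda_{i,k}=\lambda_{i,k}+\alpha(\lambda_{i,k}-\lambda_{i,k-1})$. Update phase: $$x_{i,k+1}=P_{\Omega_i}\big[\tilde x_{i,k}-\tau_i(\nabla_{x_i}f_i(\tilde x_{i,k},\tilde{\mathbf x}_{-i,k})-A_i^T\tilde\lambda_{i,k})\big],$$ $$z_{i,k+1}=\tilde z_{i,k}+\nu_i\sum_{j\in\mathcal N_i^\lambda}w_{ij}(\tilde\lambda_{i,k}-\tilde\lambda_{j,k}),$$ $$\lambda_{i,k+1}=P_{\mathbf R^m_+}\Big\{\tilde\lambda_{i,k}-\sigma_i\Big[2A_ix_{i,k+1}-A_i\tilde x_{i,k}-b_i+\sum_{j\in\mathcal N_i^\lambda}w_{ij}(\tilde\lambda_{i,k}-\tilde\lambda_{j,k})+2\sum_{j\in\mathcal N_i^\lambda}w_{ij}(z_{i,k+1}-z_{j,k+1})-\sum_{j\in\mathcal N_i^\lambda}w_{ij}(\tilde z_{i,k}-\tilde z_{j,k})\Big]\Big\}.$$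
   Formalization: Assumption 2 on Ω alone does not suffice, as extrapolated profiles may leave Ω and the iteration can then oscillate; it is additionally assumed that both inequalities of Assumption 2 hold, with the same η, θ, between each extrapolated profile (k≥1) and every point of Ω. *)

theory Defs
  imports "HOL-Analysis.Analysis"
begin

text \<open>
  Encoding of the stacked decision vector. The players form a finite type \<open>'p\<close>; the \<open>n\<close> scalar
  coordinates of a profile are indexed by a finite type \<open>'n\<close>, and \<open>pl j\<close> is the player who owns
  coordinate \<open>j\<close>. Thus \<open>n\<^sub>i\<close> is the cardinality of \<open>{j. pl j = i}\<close> and may differ from player to
  player. The space of decisions of player \<open>i\<close> is identified, isometrically, with the subspace
  \<open>player_space pl i\<close> of vectors that vanish off the coordinates owned by \<open>i\<close>.
\<close>

definition player_space :: "('n \<Rightarrow> 'p) \<Rightarrow> 'p \<Rightarrow> (real^'n) set" where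
  "player_space pl i = {v. \<forall>j. pl j \<noteq> i \<longrightarrow> v $ j = 0}"

definition block :: "('n \<Rightarrow> 'p) \<Rightarrow> 'p \<Rightarrow> real^'n \<Rightarrow> real^'n" where
  "block pl i v = (\<chi> j. if pl j = i then v $ j else 0)"

text \<open>The profile \<open>(y\<^sub>i, x\<^sub>-\<^sub>i)\<close>; it depends on \<open>y\<close> only through the coordinates of player \<open>i\<close>.\<close>

definition with_block :: "('n \<Rightarrow> 'p) \<Rightarrow> 'p \<Rightarrow> real^'n \<Rightarrow> real^'n \<Rightarrow> real^'n" where
  "with_block pl i y x = (\<chi> j. if pl j = i then y $ j else x $ j)"

text \<open>The column block \<open>A\<^sub>i\<close>, padded by zero columns so that \<open>A\<^sub>i x\<^sub>i\<close> and \<open>A\<^sub>i\<^sup>T \<lambda>\<close> make sense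
  under the identification above.\<close>

definition column_block :: "('n \<Rightarrow> 'p) \<Rightarrow> 'p \<Rightarrow> real^'n^'m \<Rightarrow> real^'n^'m" where
  "column_block pl i A = (\<chi> r j. if pl j = i then A $ r $ j else 0)"

text \<open>\<open>\<nabla>\<close> of \<open>g\<close> with respect to \<open>x\<^sub>i\<close> at the profile \<open>x\<close>. The differentiated function ignores the
  coordinates of the other players, so its gradient lies in \<open>player_space pl i\<close>.\<close>

definition partial_gradient ::
  "('n::finite \<Rightarrow> 'p) \<Rightarrow> 'p \<Rightarrow> (real^'n \<Rightarrow> real) \<Rightarrow> real^'n \<Rightarrow> real^'n" where
  "partial_gradient pl i g x = (THE D. GDERIV (\<lambda>y. g (with_block pl i y x)) x :> D)"

definition pseudo_gradient ::
  "('n::finite \<Rightarrow> 'p) \<Rightarrow> ('p \<Rightarrow> real^'n \<Rightarrow> real) \<Rightarrow> real^'n \<Rightarrow> real^'n" where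
  "pseudo_gradient pl f x = (\<chi> j. partial_gradient pl (pl j) (f (pl j)) x $ j)"

definition joint_set :: "('n \<Rightarrow> 'p) \<Rightarrow> ('p \<Rightarrow> (real^'n) set) \<Rightarrow> (real^'n) set" where
  "joint_set pl \<Omega> = {x. \<forall>i. block pl i x \<in> \<Omega> i}"

text \<open>The order on \<open>real^'m\<close> is componentwise.\<close>

definition feasible_set ::
  "('n::finite \<Rightarrow> 'p) \<Rightarrow> ('p \<Rightarrow> (real^'n) set) \<Rightarrow> real^'n^'m \<Rightarrow> real^'m::finite \<Rightarrow> (real^'n) set" where
  "feasible_set pl \<Omega> A b = joint_set pl \<Omega> \<inter> {x. b \<le> A *v x}"

definition VI_solution :: "('a::real_inner \<Rightarrow> 'a) \<Rightarrow> 'a set \<Rightarrow> 'a \<Rightarrow> bool" where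
  "VI_solution F X x \<longleftrightarrow> x \<in> X \<and> (\<forall>y\<in>X. 0 \<le> F x \<bullet> (y - x))"

definition variational_GNE where
  "variational_GNE pl f \<Omega> A b x \<longleftrightarrow> VI_solution (pseudo_gradient pl f) (feasible_set pl \<Omega> A b) x"

text \<open>The normal cone of \<open>C\<close> relative to the ambient space \<open>E\<close> in which \<open>C\<close> lives.\<close>

definition normal_cone_in :: "'a::real_inner set \<Rightarrow> 'a set \<Rightarrow> 'a \<Rightarrow> 'a set" where
  "normal_cone_in E C x = (if x \<in> C then {v\<in>E. \<forall>y\<in>C. v \<bullet> (y - x) \<le> 0} else {})"

definition nonneg_orthant :: "(real^'m::finite) set" where
  "nonneg_orthant = {l. 0 \<le> l}"

definition KKT ::
  "('n::finite \<Rightarrow> 'p) \<Rightarrow> ('p \<Rightarrow> real^'n \<Rightarrow> real) \<Rightarrow> ('p \<Rightarrow> (real^'n) set) \<Rightarrow> real^'n^'m \<Rightarrow> real^'m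
    \<Rightarrow> real^'n \<Rightarrow> real^'m::finite \<Rightarrow> bool" where
  "KKT pl f \<Omega> A b x l \<longleftrightarrow>
     (\<forall>i. \<exists>v \<in> normal_cone_in (player_space pl i) (\<Omega> i) (block pl i x).
        0 = partial_gradient pl i (f i) x - transpose (column_block pl i A) *v l + v) \<and>
     (\<exists>v \<in> normal_cone_in UNIV nonneg_orthant l. 0 = (A *v x - b) + v)"

definition assumption1 ::
  "('n::finite \<Rightarrow> 'p) \<Rightarrow> ('p \<Rightarrow> real^'n \<Rightarrow> real) \<Rightarrow> ('p \<Rightarrow> (real^'n) set) \<Rightarrow> real^'n^'m
    \<Rightarrow> real^'m::finite \<Rightarrow> bool" where
  "assumption1 pl f \<Omega> A b \<longleftrightarrow>
     (\<forall>i x. (\<lambda>y. f i (with_block pl i y x)) differentiable_on UNIV \<and>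
            convex_on UNIV (\<lambda>y. f i (with_block pl i y x))) \<and>
     (\<forall>i. closed (\<Omega> i) \<and> convex (\<Omega> i)) \<and>
     interior (feasible_set pl \<Omega> A b) \<noteq> {}"

text \<open>The two estimates at a single pair of points. They are separated from \<open>assumption2\<close> because
  the iteration evaluates \<open>F\<close> at extrapolated profiles, which need not lie in \<open>joint_set pl \<Omega>\<close>.\<close>

definition strong_mono_lipschitz_at ::
  "('a::real_inner \<Rightarrow> 'a) \<Rightarrow> real \<Rightarrow> real \<Rightarrow> 'a \<Rightarrow> 'a \<Rightarrow> bool" where
  "strong_mono_lipschitz_at F \<eta> \<theta> x y \<longleftrightarrow>
     (F x - F y) \<bullet> (x - y) \<ge> \<eta> * (norm (x - y))\<^sup>2 \<and> norm (F x - F y) \<le> \<theta> * norm (x - y)"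

definition assumption2 ::
  "('n::finite \<Rightarrow> 'p) \<Rightarrow> ('p \<Rightarrow> real^'n \<Rightarrow> real) \<Rightarrow> ('p \<Rightarrow> (real^'n) set) \<Rightarrow> real \<Rightarrow> real \<Rightarrow> bool" where
  "assumption2 pl f \<Omega> \<eta> \<theta> \<longleftrightarrow> \<eta> > 0 \<and> \<theta> > 0 \<and>
     (\<forall>x \<in> joint_set pl \<Omega>. \<forall>y \<in> joint_set pl \<Omega>.
        strong_mono_lipschitz_at (pseudo_gradient pl f) \<eta> \<theta> x y)"

definition weighted_graph :: "('p \<Rightarrow> 'p set) \<Rightarrow> real^'p^'p \<Rightarrow> bool" where
  "weighted_graph Nb W \<longleftrightarrow>
     (\<forall>i. i \<notin> Nb i) \<and> (\<forall>i j. if j \<in> Nb i then W $ i $ j > 0 else W $ i $ j = 0)"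

definition weighted_degree :: "real^'p^'p \<Rightarrow> 'p::finite \<Rightarrow> real" where
  "weighted_degree W i = (\<Sum>j\<in>UNIV. W $ i $ j)"

definition assumption3 :: "('p \<Rightarrow> 'p set) \<Rightarrow> real^'p^'p \<Rightarrow> bool" where
  "assumption3 Nb W \<longleftrightarrow>
     (\<forall>i j. j \<in> Nb i \<longleftrightarrow> i \<in> Nb j) \<and> (\<forall>i j. (i, j) \<in> {(p, q). q \<in> Nb p}\<^sup>*) \<and> W = transpose W"

text \<open>Only used for \<open>k \<ge> 1\<close>, where \<open>k - 1\<close> is the true predecessor.\<close>

definition extrapolate :: "real \<Rightarrow> (nat \<Rightarrow> 'a::real_vector) \<Rightarrow> nat \<Rightarrow> 'a" where
  "extrapolate \<alpha> u k = u k + \<alpha> *\<^sub>R (u k - u (k - 1))"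

text \<open>\<open>x k\<close> is the whole profile at step \<open>k\<close>, with \<open>block pl i (x k)\<close> the decision of player \<open>i\<close>;
  \<open>z k i\<close> and \<open>l k i\<close> are the auxiliary variable and the multiplier of player \<open>i\<close>.\<close>

definition inertial_iteration ::
  "('n::finite \<Rightarrow> 'p) \<Rightarrow> ('p \<Rightarrow> real^'n \<Rightarrow> real) \<Rightarrow> ('p \<Rightarrow> (real^'n) set) \<Rightarrow> real^'n^'m
    \<Rightarrow> ('p \<Rightarrow> real^'m) \<Rightarrow> ('p::finite \<Rightarrow> 'p set) \<Rightarrow> real^'p^'p
    \<Rightarrow> ('p \<Rightarrow> real) \<Rightarrow> ('p \<Rightarrow> real) \<Rightarrow> ('p \<Rightarrow> real) \<Rightarrow> real
    \<Rightarrow> (nat \<Rightarrow> real^'n) \<Rightarrow> (nat \<Rightarrow> 'p \<Rightarrow> real^'m) \<Rightarrow> (nat \<Rightarrow> 'p \<Rightarrow> real^'m::finite) \<Rightarrow> bool" where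
  "inertial_iteration pl f \<Omega> A bs Nb W \<tau> \<nu> \<sigma> \<alpha> x z l \<longleftrightarrow>
     (\<forall>k\<ge>1. \<forall>i.
        let xt = extrapolate \<alpha> x k;
            zt = (\<lambda>j. extrapolate \<alpha> (\<lambda>k. z k j) k);
            lt = (\<lambda>j. extrapolate \<alpha> (\<lambda>k. l k j) k);
            A\<^sub>i = column_block pl i A
        in block pl i (x (k + 1)) =
             closest_point (\<Omega> i)
               (block pl i xt - \<tau> i *\<^sub>R (partial_gradient pl i (f i) xt - transpose A\<^sub>i *v lt i)) \<and>
           z (k + 1) i = zt i + \<nu> i *\<^sub>R (\<Sum>j\<in>Nb i. (W $ i $ j) *\<^sub>R (lt i - lt j)) \<and>
           l (k + 1) i =
             closest_point nonneg_orthant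
               (lt i - \<sigma> i *\<^sub>R
                 (2 *\<^sub>R (A\<^sub>i *v block pl i (x (k + 1))) - A\<^sub>i *v block pl i xt - bs i
                  + (\<Sum>j\<in>Nb i. (W $ i $ j) *\<^sub>R (lt i - lt j))
                  + 2 *\<^sub>R (\<Sum>j\<in>Nb i. (W $ i $ j) *\<^sub>R (z (k + 1) i - z (k + 1) j))
                  - (\<Sum>j\<in>Nb i. (W $ i $ j) *\<^sub>R (zt i - zt j)))))"

end

theory Submission
  imports Defs
begin

text \<open>
  The iteration is a forward-backward splitting in disguise. Collect the decisions, the auxiliary
  variables and the multipliers into one vector \<open>u = (x, z, l)\<close>, let \<open>L\<close> be the graph Laplacian and
  \<open>\<Lambda>\<close> the block diagonal matrix of the \<open>A\<^sub>i\<close>, and let \<open>K\<close> be the product of the joint strategy set,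
  the whole space and the nonnegative orthants. With the skew map \<open>S (x, z, l) = (-\<Lambda>\<^sup>T l, -L l, \<Lambda> x + L z)\<close>,
  the map \<open>B (x, z, l) = (F x, 0, L l - bs)\<close> and a symmetric preconditioner \<open>\<Phi>\<close> that carries the
  inverse step sizes on its diagonal, each round reads: \<open>u (k+1)\<close> solves the variational inequality
  over \<open>K\<close> for \<open>v \<mapsto> \<Phi> (v - w) + B w + S v\<close>, where \<open>w\<close> is the extrapolation of the last two
  iterates (\<open>inertial_iteration_pd_step\<close>).

  The step-size bounds are diagonal dominance and give \<open>u \<bullet> \<Phi> u \<ge> \<delta> * (norm u)\<^sup>2\<close>
  (\<open>pd_metric_elliptic\<close>). Strong monotonicity together with Lipschitz continuity makes \<open>F\<close>
  cocoercive, and \<open>L\<close> is cocoercive as the Laplacian of an undirected graph; \<open>\<beta>\<close> is a common constant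
  (\<open>pd_smooth_cocoercive\<close>). Hence from \<open>w\<close> to \<open>u (k+1)\<close> the squared \<open>\<Phi>\<close>-distance to any zero decreases by at
  least \<open>1 - 1 / (2 * \<beta> * \<delta>)\<close> times the squared \<open>\<Phi>\<close>-length of this move (\<open>forward_backward_step\<close>). Extrapolation adds
  terms in the previous step, and the condition relating \<open>\<alpha>\<close>, \<open>\<beta>\<close>, \<open>\<delta>\<close> and \<open>\<epsilon>\<close> is exactly what keeps
  the balance negative (\<open>inertial_energy_inequality\<close>, \<open>inertial_descent\<close>). So distances to zeros
  converge, steps vanish, and a cluster point argument yields convergence to a zero
  (\<open>inertial_forward_backward_convergence\<close>).

  It remains to relate zeros to the game. A zero has multipliers in consensus and solves the KKT
  system, hence the variational inequality, whose solution is unique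
  (\<open>pd_zero_imp_consensus_KKT\<close>, \<open>KKT_imp_VI_solution\<close>, \<open>VI_solution_unique\<close>). Conversely a zero exists:
  the variational inequality is solvable by a contraction argument (\<open>VI_solution_exists\<close>), separation
  provides a multiplier (\<open>VI_solution_imp_KKT\<close>), and since the graph is connected the auxiliary
  variables can balance the players' residuals (\<open>KKT_imp_pd_zero\<close>).
\<close>

section \<open>Inertial preconditioned forward-backward iterations\<close>

lemma affine_recursion_tendsto_zero:
  fixes y g :: "nat \<Rightarrow> real"
  assumes rec: "\<And>k. y (Suc k) = \<alpha> * y k + g k"
    and \<alpha>: "0 \<le> \<alpha>" "\<alpha> < 1"
    and g: "g \<longlonglongrightarrow> 0"
  shows "y \<longlonglongrightarrow> 0"
proof (rule LIMSEQ_I)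
  fix r :: real assume r: "0 < r"
  \<comment> \<open>Chosen so that \<open>r / 2\<close> is the fixed point of \<open>t \<mapsto> \<alpha> * t + e\<close>.\<close>
  define e where "e = r * (1 - \<alpha>) / 2"
  have e: "e > 0" using r \<alpha> by (simp add: e_def)
  obtain K where K: "\<And>k. k \<ge> K \<Longrightarrow> \<bar>g k\<bar> < e"
    using LIMSEQ_D[OF g e] by auto
  have bd: "\<bar>y (K + n)\<bar> \<le> \<alpha> ^ n * \<bar>y K\<bar> + r / 2" for n
  proof (induction n)
    case 0 then show ?case using r by simp
  next
    case (Suc n)
    have "\<bar>y (K + Suc n)\<bar> \<le> \<alpha> * \<bar>y (K + n)\<bar> + \<bar>g (K + n)\<bar>"
      using rec[of "K + n"] abs_triangle_ineq[of "\<alpha> * y (K+n)" "g (K+n)"] \<alpha> by (simp add: abs_mult)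
    also have "\<dots> \<le> \<alpha> * (\<alpha> ^ n * \<bar>y K\<bar> + r / 2) + e"
      using mult_left_mono[OF Suc \<alpha>(1)] K[of "K + n"] by simp
    also have "\<dots> = \<alpha> ^ Suc n * \<bar>y K\<bar> + r / 2"
      by (simp add: e_def field_simps)
    finally show ?case .
  qed
  have "(\<lambda>n. \<alpha> ^ n * \<bar>y K\<bar>) \<longlonglongrightarrow> 0"
    using \<alpha> by (intro tendsto_mult_left_zero LIMSEQ_realpow_zero)
  from LIMSEQ_D[OF this, of "r/2"] r obtain M where M: "\<And>n. n \<ge> M \<Longrightarrow> \<alpha> ^ n * \<bar>y K\<bar> < r / 2"
    using \<alpha> by fastforce
  have "norm (y n - 0) < r" if "n \<ge> K + M" for n
  proof -
    have "M \<le> n - K" using that by arith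
    then show ?thesis using bd[of "n - K"] M[of "n - K"] that by simp
  qed
  then show "\<exists>no. \<forall>n\<ge>no. norm (y n - 0) < r" by blast
qed

text \<open>
  With \<open>e k\<close> measuring the size of the latest step, \<open>\<mu> k = \<phi> (k+1) - \<alpha> * \<phi> k + c * e (k+1)\<close> is
  decreasing and bounded below, so its decrements, which dominate \<open>e\<close>, vanish. The limit of
  \<open>\<phi> (k+1) - \<alpha> * \<phi> k\<close> then exists, and the affine recursion for \<open>\<phi>\<close> converges because
  \<open>\<alpha> < 1\<close>.
\<close>

lemma inertial_descent:
  fixes \<phi> e :: "nat \<Rightarrow> real"
  assumes \<phi>: "\<And>k. 0 \<le> \<phi> k" and e: "\<And>k. 0 \<le> e k"
    and \<alpha>: "0 \<le> \<alpha>" "\<alpha> < 1" and c: "0 \<le> c" "c < \<kappa>"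
    and step: "\<And>k. \<phi> (k+2) - \<phi> (k+1) - \<alpha> * (\<phi> (k+1) - \<phi> k) \<le> c * e (k+1) - \<kappa> * e (k+2)"
  shows "convergent \<phi>" and "e \<longlonglongrightarrow> 0"
proof -
  \<comment> \<open>This combination turns the second-order inequality into a monotone first-order one.\<close>
  define \<mu> where "\<mu> k = \<phi> (k+1) - \<alpha> * \<phi> k + c * e (k+1)" for k
  have drop: "\<mu> (Suc k) \<le> \<mu> k - (\<kappa> - c) * e (k+2)" for k
    using step[of k] by (simp add: \<mu>_def algebra_simps)
  then have dec: "decseq \<mu>"
    using e c by (intro decseq_SucI) (smt (verit) mult_nonneg_nonneg)
  \<comment> \<open>The larger of the initial value and the fixed point of \<open>t \<mapsto> \<alpha> * t + \<bar>\<mu> 0\<bar>\<close>.\<close>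
  define M where "M = max (\<phi> 0) (\<bar>\<mu> 0\<bar> / (1 - \<alpha>))"
  have "\<phi> k \<le> M" for k
  proof (induction k)
    case (Suc k)
    have "\<phi> (Suc k) \<le> \<alpha> * \<phi> k + \<mu> k"
      using mult_nonneg_nonneg[OF c(1) e[of "k+1"]] by (simp add: \<mu>_def)
    also have "\<dots> \<le> \<alpha> * M + \<mu> 0"
      using decseqD[OF dec, of 0 k] mult_left_mono[OF Suc \<alpha>(1)] by linarith
    also have "\<mu> 0 \<le> (1 - \<alpha>) * M"
      using \<alpha> unfolding M_def by (smt (verit) divide_le_eq mult.commute)
    finally show ?case by (simp add: algebra_simps)
  qed (simp add: M_def)
  then have low: "- (\<alpha> * M) \<le> \<mu> k" for k
    using \<phi>[of "k+1"] mult_nonneg_nonneg[OF c(1) e[of "k+1"]] mult_left_mono[OF _ \<alpha>(1), of "\<phi> k" M]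
    by (smt (verit) \<mu>_def)
  have "\<exists>m. \<mu> \<longlonglongrightarrow> m"
  proof (rule decseq_convergent[OF dec])
    show "\<forall>k. - (\<alpha> * M) \<le> \<mu> k" using low by blast
  next
    fix L assume "\<mu> \<longlonglongrightarrow> L"
    then show "\<exists>m. \<mu> \<longlonglongrightarrow> m" by (rule exI)
  qed
  then obtain m where m: "\<mu> \<longlonglongrightarrow> m" by (rule exE)
  have "(\<lambda>k. (\<mu> k - \<mu> (Suc k)) / (\<kappa> - c)) \<longlonglongrightarrow> (m - m) / (\<kappa> - c)"
    using c by (intro tendsto_divide tendsto_diff tendsto_const m LIMSEQ_Suc[OF m]) auto
  then have "(\<lambda>k. (\<mu> k - \<mu> (Suc k)) / (\<kappa> - c)) \<longlonglongrightarrow> 0" by simp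
  moreover have "norm (e (k+2)) \<le> (\<mu> k - \<mu> (Suc k)) / (\<kappa> - c)" for k
  proof -
    have "e (k+2) * (\<kappa> - c) \<le> \<mu> k - \<mu> (Suc k)"
      using drop[of k] by (simp only: mult.commute)
    then show ?thesis using e[of "k+2"] c by (simp add: pos_le_divide_eq)
  qed
  ultimately have "(\<lambda>k. e (k+2)) \<longlonglongrightarrow> 0"
    by (rule Lim_null_comparison[OF always_eventually, OF allI, rotated])
  then show e0: "e \<longlonglongrightarrow> 0"
    by (rule LIMSEQ_offset)
  define y where "y k = \<phi> k - m / (1 - \<alpha>)" for k
  have "y \<longlonglongrightarrow> 0"
  proof (rule affine_recursion_tendsto_zero[OF _ \<alpha>])
    show "y (Suc k) = \<alpha> * y k + (\<mu> k - m - c * e (k+1))" for k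
      using \<alpha> by (simp add: y_def \<mu>_def field_simps)
    have "(\<lambda>k. \<mu> k - m - c * e (k+1)) \<longlonglongrightarrow> m - m - c * 0"
      by (intro tendsto_intros m LIMSEQ_ignore_initial_segment[OF e0])
    then show "(\<lambda>k. \<mu> k - m - c * e (k+1)) \<longlonglongrightarrow> 0" by simp
  qed
  then have "(\<lambda>k. y k + m / (1 - \<alpha>)) \<longlonglongrightarrow> 0 + m / (1 - \<alpha>)"
    by (intro tendsto_add tendsto_const)
  then show "convergent \<phi>"
    by (auto simp: y_def convergent_def)
qed

lemma self_adjoint_quadratic_expand:
  assumes "linear \<Phi>" and "\<And>a b. \<Phi> a \<bullet> b = a \<bullet> \<Phi> b"
  shows "(a + r *\<^sub>R b) \<bullet> \<Phi> (a + r *\<^sub>R b) = a \<bullet> \<Phi> a + 2 * r * (a \<bullet> \<Phi> b) + r\<^sup>2 * (b \<bullet> \<Phi> b)"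
  using assms(2)[of b a]
  by (simp add: linear_add[OF assms(1)] linear_scale[OF assms(1)] inner_add_left inner_add_right
      power2_eq_square algebra_simps inner_commute)

text \<open>
  One preconditioned forward-backward step from \<open>w\<close> to \<open>v\<close> is quasi-nonexpansive towards a zero
  \<open>s\<close>, with a surplus. Monotonicity of \<open>S\<close> makes the backward part cost nothing. The forward part is
  evaluated at \<open>w\<close> rather than at \<open>v\<close>; the price \<open>norm (v - w)\<^sup>2 / (4 * \<beta>)\<close> of this mismatch is paid
  from the surplus, and \<open>2 * \<beta> * \<delta> > 1\<close> is what leaves some of it.
\<close>

lemma forward_backward_step:
  fixes B S \<Phi> :: "'a::real_inner \<Rightarrow> 'a"
  assumes lin: "linear \<Phi>" and adj: "\<And>a b. \<Phi> a \<bullet> b = a \<bullet> \<Phi> b"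
    and elliptic: "\<And>a. \<delta> * (norm a)\<^sup>2 \<le> a \<bullet> \<Phi> a" and \<delta>: "0 < \<delta>" and \<beta>: "0 < \<beta>"
    and mono: "0 \<le> (S v - S s) \<bullet> (v - s)"
    and coco: "\<beta> * (norm (B w - B s))\<^sup>2 \<le> (B w - B s) \<bullet> (w - s)"
    and step: "0 \<le> (\<Phi> (v - w) + B w + S v) \<bullet> (s - v)"
    and zero: "0 \<le> (B s + S s) \<bullet> (v - s)"
  shows "(v - s) \<bullet> \<Phi> (v - s)
     \<le> (w - s) \<bullet> \<Phi> (w - s) - (1 - 1 / (2 * \<beta> * \<delta>)) * ((v - w) \<bullet> \<Phi> (v - w))"
proof -
  define D where "D = B w - B s"
  have "\<Phi> (v - w) \<bullet> (v - s) \<le> - (D \<bullet> (v - s))"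
    using step zero mono by (simp add: D_def algebra_simps)
  also have "\<dots> = - (D \<bullet> (w - s)) - D \<bullet> (v - w)"
    by (simp add: algebra_simps)
  also have "\<dots> \<le> - \<beta> * (norm D)\<^sup>2 - D \<bullet> (v - w)"
    using coco by (simp add: D_def)
  \<comment> \<open>Completing the square in \<open>D\<close> absorbs the cross term into the cocoercivity margin.\<close>
  also have "\<dots> \<le> (norm (v - w))\<^sup>2 / (4 * \<beta>)"
  proof -
    define E where "E = v - w"
    have "0 \<le> (norm (D + (1 / (2 * \<beta>)) *\<^sub>R E))\<^sup>2" by simp
    also have "\<dots> = (norm D)\<^sup>2 + D \<bullet> E / \<beta> + (norm E)\<^sup>2 / (4 * \<beta>\<^sup>2)"
      unfolding power2_norm_eq_inner
      using \<beta> by (simp add: inner_add_left inner_add_right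
          inner_commute[of E D] field_simps power2_eq_square)
    finally have "0 \<le> \<beta> * ((norm D)\<^sup>2 + D \<bullet> E / \<beta> + (norm E)\<^sup>2 / (4 * \<beta>\<^sup>2))"
      using \<beta> by simp
    also have "\<dots> = \<beta> * (norm D)\<^sup>2 + D \<bullet> E + (norm E)\<^sup>2 / (4 * \<beta>)"
      using \<beta> by (simp add: field_simps power2_eq_square)
    finally show ?thesis by (simp add: E_def)
  qed
  also have "\<dots> \<le> ((v - w) \<bullet> \<Phi> (v - w)) / \<delta> / (4 * \<beta>)"
    using elliptic[of "v - w"] \<delta> \<beta> by (intro divide_right_mono) (auto simp: field_simps)
  finally have key: "\<Phi> (v - w) \<bullet> (v - s) \<le> ((v - w) \<bullet> \<Phi> (v - w)) / (4 * \<beta> * \<delta>)"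
    by (simp add: field_simps)
  define q where "q a = a \<bullet> \<Phi> a" for a
  have "q (w - s) = q (v - s) - 2 * (\<Phi> (v - w) \<bullet> (v - s)) + q (v - w)"
    using self_adjoint_quadratic_expand[OF lin adj, of "v - s" "-1" "v - w"]
    by (simp add: q_def inner_commute)
  moreover have "\<Phi> (v - w) \<bullet> (v - s) \<le> q (v - w) / (4 * \<beta> * \<delta>)"
    using key by (simp add: q_def)
  moreover have "(1 - 1 / (2 * \<beta> * \<delta>)) * q (v - w) = q (v - w) - 2 * (q (v - w) / (4 * \<beta> * \<delta>))"
    by (simp add: algebra_simps)
  ultimately show ?thesis unfolding q_def[symmetric] by linarith
qed

text \<open>
  Rewrites the one-step estimate at the extrapolated point \<open>w\<close> in terms of the iterates alone. The
  energy at \<open>w\<close> is an exact combination of those at \<open>u\<close>, \<open>t\<close> and of the step \<open>u - t\<close>; the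
  residual \<open>v - w\<close> is bounded below by the two successive steps through the inequality
  \<open>2 * (a \<bullet> \<Phi> b) \<le> a \<bullet> \<Phi> a + b \<bullet> \<Phi> b\<close>.
\<close>

lemma inertial_energy_inequality:
  fixes \<Phi> :: "'a::real_inner \<Rightarrow> 'a"
  assumes lin: "linear \<Phi>" and adj: "\<And>a b. \<Phi> a \<bullet> b = a \<bullet> \<Phi> b"
    and pos: "\<And>a. 0 \<le> a \<bullet> \<Phi> a" and \<alpha>: "0 \<le> \<alpha>" and \<gamma>: "0 \<le> \<gamma>"
    and w: "w = u + \<alpha> *\<^sub>R (u - t)"
    and fb: "(v - s) \<bullet> \<Phi> (v - s) \<le> (w - s) \<bullet> \<Phi> (w - s) - \<gamma> * ((v - w) \<bullet> \<Phi> (v - w))"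
  shows "(v - s) \<bullet> \<Phi> (v - s) - (u - s) \<bullet> \<Phi> (u - s)
      - \<alpha> * ((u - s) \<bullet> \<Phi> (u - s) - (t - s) \<bullet> \<Phi> (t - s))
    \<le> (\<alpha> * (1 + \<alpha>) + \<gamma> * \<alpha> * (1 - \<alpha>)) * ((u - t) \<bullet> \<Phi> (u - t))
      - \<gamma> * (1 - \<alpha>) * ((v - u) \<bullet> \<Phi> (v - u))"
proof -
  note ex = self_adjoint_quadratic_expand[OF lin adj]
  define q where "q a = a \<bullet> \<Phi> a" for a
  have 1: "q (w - s) = (1 + \<alpha>) * q (u - s) - \<alpha> * q (t - s) + \<alpha> * (1 + \<alpha>) * q (u - t)"
  proof -
    define p where "p = (u - s) \<bullet> \<Phi> (u - t)"
    have "w - s = u - s + \<alpha> *\<^sub>R (u - t)" by (simp add: w)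
    then have "q (w - s) = q (u - s) + 2 * \<alpha> * p + \<alpha>\<^sup>2 * q (u - t)"
      using ex[of "u - s" \<alpha> "u - t"] by (simp only: q_def p_def)
    moreover have "q (t - s) = q (u - s) - 2 * p + q (u - t)"
      using ex[of "u - s" "-1" "u - t"] by (simp add: q_def p_def)
    then have "\<alpha> * q (t - s) = \<alpha> * q (u - s) - 2 * \<alpha> * p + \<alpha> * q (u - t)"
      by (simp add: distrib_left right_diff_distrib)
    ultimately have "q (w - s)
        = q (u - s) + (\<alpha> * q (u - s) - \<alpha> * q (t - s) + \<alpha> * q (u - t)) + \<alpha>\<^sup>2 * q (u - t)"
      by linarith
    then show ?thesis by (simp only: power2_eq_square) (simp add: algebra_simps)
  qed
  have 2: "(1 - \<alpha>) * q (v - u) - \<alpha> * (1 - \<alpha>) * q (u - t) \<le> q (v - w)"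
  proof -
    define p where "p = (v - u) \<bullet> \<Phi> (u - t)"
    have vw: "v - w = v - u + (- \<alpha>) *\<^sub>R (u - t)" by (simp add: w)
    have "q (v - w) = q (v - u) - 2 * \<alpha> * p + \<alpha>\<^sup>2 * q (u - t)"
      unfolding vw using ex[of "v - u" "-\<alpha>" "u - t"] by (simp add: q_def p_def)
    moreover have "0 \<le> q (v - u) - 2 * p + q (u - t)"
      using ex[of "v - u" "-1" "u - t"] pos[of "v - u + (-1) *\<^sub>R (u - t)"]
      by (simp add: q_def p_def)
    then have "0 \<le> \<alpha> * (q (v - u) - 2 * p + q (u - t))"
      using \<alpha> by simp
    ultimately show ?thesis by (simp add: algebra_simps power2_eq_square)
  qed
  show ?thesis
    using fb mult_left_mono[OF 2 \<gamma>] unfolding q_def[symmetric] 1 by (simp add: algebra_simps)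
qed

text \<open>
  Each zero \<open>s\<close> gives a convergent energy \<open>(u k - s) \<bullet> \<Phi> (u k - s)\<close>, and successive steps vanish.
  In finite dimension a cluster point exists; it is a zero because the variational inequality passes
  to the limit, and the convergence of the energy to this very zero upgrades the subsequential limit
  to a limit. Cocoercivity and Lipschitz continuity of \<open>B\<close> are required only between extrapolated
  iterates and points of the relevant set, since extrapolation may leave \<open>K\<close>.
\<close>

theorem inertial_forward_backward_convergence:
  fixes u :: "nat \<Rightarrow> 'a::euclidean_space" and B S \<Phi> :: "'a \<Rightarrow> 'a" and K :: "'a set"
  defines "Z \<equiv> {s \<in> K. \<forall>y\<in>K. 0 \<le> (B s + S s) \<bullet> (y - s)}"
  assumes K: "closed K"
    and S: "linear S" "\<And>v. 0 \<le> S v \<bullet> v"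
    and \<Phi>: "linear \<Phi>" "\<And>a b. \<Phi> a \<bullet> b = a \<bullet> \<Phi> b"
      "\<And>a. \<delta> * (norm a)\<^sup>2 \<le> a \<bullet> \<Phi> a"
    and pos: "0 < \<beta>" "0 < \<epsilon>" "1 / (2 * \<beta>) < \<delta>"
    and \<alpha>: "0 \<le> \<alpha>" "\<alpha> < 1"
    and inertia: "(1 - \<alpha>)\<^sup>2 \<le> 2 * \<beta> * \<delta> * (1 - 3 * \<alpha> - \<epsilon>)"
    and iter: "\<And>k. k \<ge> 1 \<Longrightarrow> u (k + 1) \<in> K"
      "\<And>k y. k \<ge> 1 \<Longrightarrow> y \<in> K \<Longrightarrow>
         0 \<le> (\<Phi> (u (k + 1) - extrapolate \<alpha> u k) + B (extrapolate \<alpha> u k) + S (u (k + 1)))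
               \<bullet> (y - u (k + 1))"
    and coco: "\<And>k s. k \<ge> 1 \<Longrightarrow> s \<in> Z \<Longrightarrow>
         \<beta> * (norm (B (extrapolate \<alpha> u k) - B s))\<^sup>2
           \<le> (B (extrapolate \<alpha> u k) - B s) \<bullet> (extrapolate \<alpha> u k - s)"
    and lip: "\<And>k s. k \<ge> 1 \<Longrightarrow> s \<in> K \<Longrightarrow>
         norm (B (extrapolate \<alpha> u k) - B s) \<le> C * norm (extrapolate \<alpha> u k - s)"
    and nonempty: "Z \<noteq> {}"
  shows "\<exists>s\<in>Z. u \<longlonglongrightarrow> s"
proof -
  define \<gamma> where "\<gamma> = 1 - 1 / (2 * \<beta> * \<delta>)"
  define c where "c = \<alpha> * (1 + \<alpha>) + \<gamma> * \<alpha> * (1 - \<alpha>)"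
  have "0 < 1 / (2 * \<beta>)" using pos by simp
  then have \<delta>: "0 < \<delta>" using pos by linarith
  have \<gamma>: "0 \<le> \<gamma>" using pos \<delta> by (simp add: \<gamma>_def field_simps)
  have c: "0 \<le> c" using \<gamma> \<alpha> by (simp add: c_def)
  have "(1 - \<alpha>)\<^sup>2 / (2 * \<beta> * \<delta>) \<le> 1 - 3 * \<alpha> - \<epsilon>"
    using inertia pos \<delta> by (simp add: divide_le_eq mult.commute)
  moreover have "\<gamma> * (1 - \<alpha>) - c = (1 - \<alpha>)\<^sup>2 - (1 - \<alpha>)\<^sup>2 / (2 * \<beta> * \<delta>) - \<alpha> - \<alpha>\<^sup>2"
    using pos \<delta> by (simp add: c_def \<gamma>_def power2_eq_square field_simps)
  moreover have "(1 - \<alpha>)\<^sup>2 = 1 - 2 * \<alpha> + \<alpha>\<^sup>2" by (simp add: power2_eq_square algebra_simps)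
  \<comment> \<open>The inertia condition says precisely that this gap is at least \<open>\<epsilon>\<close>.\<close>
  ultimately have c2: "c < \<gamma> * (1 - \<alpha>)" using pos by linarith
  have lin_tendsto: "(\<lambda>k. T (a k)) \<longlonglongrightarrow> T x" if "linear T" "a \<longlonglongrightarrow> x" for T :: "'a \<Rightarrow> 'a" and a x
    using bounded_linear.tendsto that by (auto simp: linear_conv_bounded_linear)
  define w where "w = extrapolate \<alpha> u"
  define q where "q a = a \<bullet> \<Phi> a" for a
  have q0: "0 \<le> q a" for a using \<Phi>(3)[of a] \<delta> by (smt (verit) q_def mult_nonneg_nonneg zero_le_power2)
  have q_norm: "(norm a)\<^sup>2 \<le> q a / \<delta>" for a
    using \<Phi>(3)[of a] \<delta> by (simp add: q_def field_simps)
  have desc: "q (u (k+2) - s) - q (u (k+1) - s) - \<alpha> * (q (u (k+1) - s) - q (u k - s))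
      \<le> c * q (u (k+1) - u k) - \<gamma> * (1 - \<alpha>) * q (u (k+2) - u (k+1))" if s: "s \<in> Z" for s k
  proof -
    have "q (u (k+1+1) - s) \<le> q (w (k+1) - s) - \<gamma> * q (u (k+1+1) - w (k+1))"
      unfolding q_def \<gamma>_def
    proof (rule forward_backward_step[OF \<Phi> \<delta> pos(1)])
      show "0 \<le> (S (u (k+1+1)) - S s) \<bullet> (u (k+1+1) - s)"
        using S(2)[of "u (k+1+1) - s"] by (simp add: linear_diff[OF S(1)])
      show "0 \<le> (B s + S s) \<bullet> (u (k+1+1) - s)"
        using s iter(1)[of "k+1"] by (simp add: Z_def)
      have "s \<in> K" using s by (simp add: Z_def)
      then show "0 \<le> (\<Phi> (u (k+1+1) - w (k+1)) + B (w (k+1)) + S (u (k+1+1))) \<bullet> (s - u (k+1+1))"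
        using iter(2)[of "k+1" s] by (simp add: w_def)
    qed (use coco[of "k+1" s] s in \<open>simp add: w_def\<close>)
    then show ?thesis
      using inertial_energy_inequality[OF \<Phi>(1,2) q0[unfolded q_def] \<alpha>(1) \<gamma>,
          of "w (k+1)" "u (k+1)" "u k" "u (k+1+1)" s]
      by (simp add: q_def c_def w_def extrapolate_def)
  qed
  define e where "e k = q (u k - u (k - 1))" for k
  have conv: "convergent (\<lambda>k. q (u k - s))" and e: "e \<longlonglongrightarrow> 0" if "s \<in> Z" for s
    using inertial_descent[of "\<lambda>k. q (u k - s)" e \<alpha> c "\<gamma> * (1 - \<alpha>)"] desc[OF that] q0 c c2 \<alpha>
    by (auto simp: e_def)
  obtain s0 where s0: "s0 \<in> Z" using nonempty by blast
  have null: "a \<longlonglongrightarrow> 0" if "(\<lambda>k. q (a k)) \<longlonglongrightarrow> 0" for a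
  proof -
    have "(\<lambda>k. q (a k) / \<delta>) \<longlonglongrightarrow> 0" using tendsto_divide_zero[OF that] .
    then have "(\<lambda>k. (norm (a k))\<^sup>2) \<longlonglongrightarrow> 0"
      by (rule Lim_null_comparison[rotated]) (auto simp: q_norm)
    then have "(\<lambda>k. sqrt ((norm (a k))\<^sup>2)) \<longlonglongrightarrow> sqrt 0" by (rule tendsto_real_sqrt)
    then show ?thesis by (simp add: tendsto_norm_zero_iff)
  qed
  have d: "(\<lambda>k. u k - u (k - 1)) \<longlonglongrightarrow> 0"
    using null[of "\<lambda>k. u k - u (k - 1)"] e[OF s0] by (simp add: e_def[abs_def])
  \<comment> \<open>The energy to one zero is convergent, hence bounded, and the metric is elliptic.\<close>
  have "bounded (range u)"
  proof -
    obtain M where M: "\<And>k. norm (q (u k - s0)) \<le> M"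
      using convergent_imp_Bseq[OF conv[OF s0]] by (auto simp: Bseq_def)
    have "dist s0 (u k) \<le> sqrt (M / \<delta>)" for k
    proof -
      have "(norm (u k - s0))\<^sup>2 \<le> M / \<delta>"
        using q_norm[of "u k - s0"] M[of k] \<delta> q0[of "u k - s0"]
        by (smt (verit) divide_right_mono real_norm_def)
      then show ?thesis by (simp add: dist_norm norm_minus_commute real_le_rsqrt)
    qed
    then show ?thesis unfolding bounded_def by blast
  qed
  then obtain s r where r: "strict_mono r" and s: "(u \<circ> r) \<longlonglongrightarrow> s"
    using bounded_imp_convergent_subsequence by blast
  have ur: "(\<lambda>k. u (r k)) \<longlonglongrightarrow> s" using s by (simp add: o_def)
  have r_ge: "1 \<le> r k" if "1 \<le> k" for k using seq_suble[OF r, of k] that by linarith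
  have dr: "(\<lambda>k. u (r k) - u (r k - 1)) \<longlonglongrightarrow> 0"
    using LIMSEQ_subseq_LIMSEQ[OF d r] by (simp add: o_def)
  have dr1: "(\<lambda>k. u (r k + 1) - u (r k)) \<longlonglongrightarrow> 0"
    using LIMSEQ_subseq_LIMSEQ[OF LIMSEQ_Suc[OF d] r] by (simp add: o_def)
  have u1: "(\<lambda>k. u (r k + 1)) \<longlonglongrightarrow> s"
    using tendsto_add[OF dr1 ur] by simp
  have wr: "(\<lambda>k. w (r k)) \<longlonglongrightarrow> s"
    using tendsto_add[OF ur tendsto_scaleR[OF tendsto_const[of \<alpha>] dr]]
    by (simp add: w_def extrapolate_def)
  have ev: "\<forall>\<^sub>F k in sequentially. 1 \<le> r k"
    using r_ge eventually_sequentially by blast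
  have sK: "s \<in> K"
    by (rule Lim_in_closed_set[OF K _ _ u1]) (use ev iter(1) in \<open>auto elim: eventually_mono\<close>)
  have Bw: "(\<lambda>k. B (w (r k))) \<longlonglongrightarrow> B s"
  proof -
    have "(\<lambda>k. C * norm (w (r k) - s)) \<longlonglongrightarrow> 0"
      using wr by (intro tendsto_mult_right_zero) (simp add: LIM_zero tendsto_norm_zero)
    then have "(\<lambda>k. B (w (r k)) - B s) \<longlonglongrightarrow> 0"
      by (rule Lim_null_comparison[rotated])
         (use ev lip sK in \<open>auto simp: w_def elim: eventually_mono\<close>)
    then show ?thesis by (simp add: LIM_zero_iff)
  qed
  \<comment> \<open>The displacement in the preconditioner vanishes in the limit, so the cluster point is a zero.\<close>
  have "s \<in> Z"
    unfolding Z_def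
  proof (intro CollectI conjI sK ballI)
    fix y assume y: "y \<in> K"
    have "(\<lambda>k. (\<Phi> (u (r k + 1) - w (r k)) + B (w (r k)) + S (u (r k + 1))) \<bullet> (y - u (r k + 1)))
      \<longlonglongrightarrow> (\<Phi> (s - s) + B s + S s) \<bullet> (y - s)"
      by (intro tendsto_intros u1 wr Bw lin_tendsto[OF \<Phi>(1)] lin_tendsto[OF S(1)])
    moreover have "\<forall>\<^sub>F k in sequentially.
        0 \<le> (\<Phi> (u (r k + 1) - w (r k)) + B (w (r k)) + S (u (r k + 1))) \<bullet> (y - u (r k + 1))"
      using ev by (rule eventually_mono) (use iter(2) y in \<open>auto simp: w_def\<close>)
    ultimately have "0 \<le> (\<Phi> (s - s) + B s + S s) \<bullet> (y - s)"
      using tendsto_lowerbound sequentially_bot by blast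
    then show "0 \<le> (B s + S s) \<bullet> (y - s)" by (simp add: linear_0[OF \<Phi>(1)])
  qed
  moreover have "u \<longlonglongrightarrow> s"
  proof -
    obtain L where L: "(\<lambda>k. q (u k - s)) \<longlonglongrightarrow> L"
      using conv[OF \<open>s \<in> Z\<close>] by (auto simp: convergent_def)
    have "(\<lambda>k. q (u (r k) - s)) \<longlonglongrightarrow> (s - s) \<bullet> \<Phi> (s - s)"
      unfolding q_def
      by (intro tendsto_intros ur lin_tendsto[OF \<Phi>(1)])
    moreover have "(\<lambda>k. q (u (r k) - s)) \<longlonglongrightarrow> L"
      using LIMSEQ_subseq_LIMSEQ[OF L r] by (simp add: o_def)
    \<comment> \<open>The energy to the cluster point itself converges, and along the subsequence its limit is zero.\<close>
    ultimately have "L = 0" using LIMSEQ_unique by fastforce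
    then show ?thesis using null[of "\<lambda>k. u k - s"] L by (simp add: LIM_zero_iff)
  qed
  ultimately show ?thesis by blast
qed

section \<open>Variational inequalities and Lagrange multipliers\<close>

lemma VI_solution_unique:
  assumes "VI_solution F X x" "VI_solution F X y"
    and "\<And>x y. x \<in> X \<Longrightarrow> y \<in> X \<Longrightarrow> strong_mono_lipschitz_at F \<eta> \<theta> x y" and "0 < \<eta>"
  shows "x = y"
proof -
  have "\<eta> * (norm (x - y))\<^sup>2 \<le> (F x - F y) \<bullet> (x - y)"
    using assms by (auto simp: VI_solution_def strong_mono_lipschitz_at_def)
  also have "\<dots> \<le> 0"
    using assms(1,2) unfolding VI_solution_def
    by (smt (verit) inner_diff_left inner_diff_right)
  finally show ?thesis using \<open>0 < \<eta>\<close>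
    by (smt (verit) mult_pos_pos right_minus_eq zero_less_norm_iff zero_less_power)
qed

text \<open>
  Solutions are the fixed points of the projected step \<open>x \<mapsto> P(x - \<rho> F x)\<close>, which is a contraction
  for \<open>\<rho> = \<eta> / \<theta>\<^sup>2\<close>.
\<close>

lemma VI_solution_exists:
  fixes F :: "'a::euclidean_space \<Rightarrow> 'a"
  assumes X: "closed X" "convex X" "X \<noteq> {}"
    and F: "\<And>x y. x \<in> X \<Longrightarrow> y \<in> X \<Longrightarrow> strong_mono_lipschitz_at F \<eta> \<theta> x y"
    and pos: "0 < \<eta>" "0 < \<theta>"
  shows "\<exists>x. VI_solution F X x"
proof -
  \<comment> \<open>The minimiser of the squared contraction factor \<open>1 - 2 * \<rho> * \<eta> + \<rho>\<^sup>2 * \<theta>\<^sup>2\<close>.\<close>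
  define \<rho> where "\<rho> = \<eta> / \<theta>\<^sup>2"
  define T where "T x = closest_point X (x - \<rho> *\<^sub>R F x)" for x
  define q where "q = 1 - \<eta>\<^sup>2 / \<theta>\<^sup>2"
  define c where "c = sqrt (max 0 q)"
  have \<rho>: "0 < \<rho>" using pos by (simp add: \<rho>_def)
  have "q < 1" using pos by (simp add: q_def)
  then have c: "0 \<le> c" "c < 1" by (auto simp: c_def)
  have contr: "dist (T x) (T y) \<le> c * dist x y" if xy: "x \<in> X" "y \<in> X" for x y
  proof -
    define D where "D = F x - F y"
    have D: "\<eta> * (norm (x - y))\<^sup>2 \<le> (x - y) \<bullet> D" "norm D \<le> \<theta> * norm (x - y)"
      using F[OF xy] by (auto simp: strong_mono_lipschitz_at_def D_def inner_commute)
    have D2: "(norm D)\<^sup>2 \<le> \<theta>\<^sup>2 * (norm (x - y))\<^sup>2"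
      using power_mono[OF D(2), of 2] by (simp add: power_mult_distrib)
    have "(norm (x - y - \<rho> *\<^sub>R D))\<^sup>2
        = (norm (x - y))\<^sup>2 - 2 * \<rho> * ((x - y) \<bullet> D) + \<rho>\<^sup>2 * (norm D)\<^sup>2"
      using dot_norm_neg[of "x - y" "\<rho> *\<^sub>R D"] by (simp add: power_mult_distrib)
    also have "\<dots> \<le> (norm (x - y))\<^sup>2 - 2 * \<rho> * (\<eta> * (norm (x - y))\<^sup>2)
        + \<rho>\<^sup>2 * (\<theta>\<^sup>2 * (norm (x - y))\<^sup>2)"
      using D(1) D2 \<rho> by (intro add_mono diff_mono mult_left_mono order_refl) auto
    also have "\<dots> = q * (norm (x - y))\<^sup>2"
      using pos by (simp add: \<rho>_def q_def field_simps power2_eq_square)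
    also have "\<dots> \<le> max 0 q * (norm (x - y))\<^sup>2"
      by (intro mult_right_mono) auto
    finally have "norm (x - y - \<rho> *\<^sub>R D) \<le> c * norm (x - y)"
      using real_le_rsqrt by (fastforce simp: c_def real_sqrt_mult)
    moreover have "dist (T x) (T y) \<le> norm (x - y - \<rho> *\<^sub>R D)"
      using closest_point_lipschitz[OF X(2,1,3), of "x - \<rho> *\<^sub>R F x" "y - \<rho> *\<^sub>R F y"]
      by (simp add: T_def D_def dist_norm algebra_simps)
    ultimately show ?thesis by (simp add: dist_norm)
  qed
  have "T ` X \<subseteq> X" using closest_point_in_set[OF X(1,3)] by (auto simp: T_def)
  then obtain x where x: "x \<in> X" "T x = x"
    using Banach_fix[of X c T] X c contr by (auto simp: complete_eq_closed)
  have "VI_solution F X x"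
    unfolding VI_solution_def
  proof (intro conjI ballI x(1))
    fix y assume "y \<in> X"
    from closest_point_dot[OF X(2,1) this, of "x - \<rho> *\<^sub>R F x"]
    have "0 \<le> \<rho> * (F x \<bullet> (y - x))" using x(2) by (simp add: T_def)
    then show "0 \<le> F x \<bullet> (y - x)" using \<rho> by (simp add: zero_le_mult_iff)
  qed
  then show ?thesis by blast
qed

text \<open>
  Separate the origin from the set of pairs of an achievable objective excess and an achievable
  constraint violation. The normal of the hyperplane has nonnegative components; the Slater point
  makes its objective component positive, and dividing by that component leaves the multiplier.
\<close>

lemma slater_multiplier:
  fixes A :: "real^'n::finite^'m::finite"
  assumes C: "convex C" and x: "x \<in> C" "b \<le> A *v x"
    and opt: "\<And>y. y \<in> C \<Longrightarrow> b \<le> A *v y \<Longrightarrow> 0 \<le> c \<bullet> (y - x)"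
    and slater: "x0 \<in> C" "\<And>r. b $ r < (A *v x0) $ r"
  shows "\<exists>l. 0 \<le> l \<and> l \<bullet> (A *v x - b) = 0 \<and> (\<forall>y\<in>C. 0 \<le> (c - transpose A *v l) \<bullet> (y - x))"
proof -
  \<comment> \<open>Strictness in the first component only: this keeps \<open>0\<close> outside of \<open>M\<close> by optimality of \<open>x\<close>.\<close>
  define M where "M = {(t :: real, s :: real^'m). \<exists>y\<in>C. c \<bullet> (y - x) < t \<and> b - A *v y \<le> s}"
  have "convex M"
  proof (rule convexI)
    fix p q :: "real \<times> (real^'m)" and v w :: real
    assume p: "p \<in> M" and q: "q \<in> M" and vw: "0 \<le> v" "0 \<le> w" "v + w = 1"
    obtain t s y where y: "p = (t, s)" "y \<in> C" "c \<bullet> (y - x) < t" "b - A *v y \<le> s"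
      using p by (auto simp: M_def)
    obtain t' s' y' where y': "q = (t', s')" "y' \<in> C" "c \<bullet> (y' - x) < t'" "b - A *v y' \<le> s'"
      using q by (auto simp: M_def)
    have w: "w = 1 - v" using vw by simp
    have "c \<bullet> (v *\<^sub>R y + w *\<^sub>R y' - x) = v * (c \<bullet> (y - x)) + w * (c \<bullet> (y' - x))"
      by (simp add: w algebra_simps)
    also have "\<dots> < v * t + w * t'"
    proof (cases "v = 0")
      case True then show ?thesis using y' w by simp
    next
      case False
      then have "v * (c \<bullet> (y - x)) < v * t" using y vw by simp
      moreover have "w * (c \<bullet> (y' - x)) \<le> w * t'" using y' vw by (simp add: mult_left_mono)
      ultimately show ?thesis by simp
    qed
    finally have 1: "c \<bullet> (v *\<^sub>R y + w *\<^sub>R y' - x) < v * t + w * t'" .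
    have "b - A *v (v *\<^sub>R y + w *\<^sub>R y') = v *\<^sub>R (b - A *v y) + w *\<^sub>R (b - A *v y')"
      by (simp add: w matrix_vector_mult_add_rdistrib matrix_vector_right_distrib
          matrix_vector_mult_scaleR algebra_simps)
    also have "\<dots> \<le> v *\<^sub>R s + w *\<^sub>R s'"
      using y y' vw by (simp add: less_eq_vec_def add_mono mult_left_mono)
    finally show "v *\<^sub>R p + w *\<^sub>R q \<in> M"
      using 1 convexD[OF C y(2) y'(2) vw] y(1) y'(1) by (auto simp: M_def)
  qed
  moreover have "0 \<notin> M"
  proof
    assume "0 \<in> M"
    then obtain y where "y \<in> C" "c \<bullet> (y - x) < 0" "b - A *v y \<le> 0"
      by (auto simp: M_def zero_prod_def)
    then show False using opt[of y] by simp
  qed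
  ultimately have "\<exists>a. a \<noteq> 0 \<and> (\<forall>m\<in>M. 0 \<le> a \<bullet> m)"
    by (rule separating_hyperplane_set_0)
  then obtain a where a: "a \<noteq> 0" "\<And>m. m \<in> M \<Longrightarrow> 0 \<le> a \<bullet> m" by blast
  obtain p l where pl: "a = (p, l)" by (cases a)
  have sep: "0 \<le> p * t + l \<bullet> s" if "y \<in> C" "c \<bullet> (y - x) < t" "b - A *v y \<le> s" for y t s
    using a(2)[of "(t, s)"] that by (auto simp: M_def pl)
  have p0: "0 \<le> p"
  proof (rule ccontr)
    assume neg: "\<not> 0 \<le> p"
    \<comment> \<open>Large enough that a negative \<open>p\<close> would push the linear functional below zero.\<close>
    define t where "t = 1 + \<bar>l \<bullet> (b - A *v x)\<bar> / (- p)"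
    have t: "0 < t" using neg by (simp add: t_def add_pos_nonneg divide_nonneg_pos)
    have "p * t = p - \<bar>l \<bullet> (b - A *v x)\<bar>" using neg by (simp add: t_def field_simps)
    moreover have "0 \<le> p * t + l \<bullet> (b - A *v x)" by (rule sep[OF x(1)]) (use t in simp_all)
    ultimately show False using neg by linarith
  qed
  have l0: "0 \<le> l"
    unfolding less_eq_vec_def
  proof (intro allI, rule ccontr)
    fix r assume "\<not> (0::real^'m) $ r \<le> l $ r"
    then have neg: "l $ r < 0" by simp
    \<comment> \<open>\<open>M\<close> is unbounded upwards in direction \<open>r\<close>; going \<open>k\<close> far makes the functional equal to at most \<open>-1\<close>.\<close>
    define k where "k = (1 + \<bar>p + l \<bullet> (b - A *v x)\<bar>) / (- (l $ r))"
    have k: "0 \<le> k" unfolding k_def by (rule divide_nonneg_pos) (use neg in auto)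
    have "b - A *v x \<le> b - A *v x + k *\<^sub>R axis r 1"
      using k by (auto simp: less_eq_vec_def axis_def)
    from sep[OF x(1) _ this, of 1]
    have "0 \<le> p + l \<bullet> (b - A *v x) + k * l $ r"
      by (simp add: inner_add_right inner_axis)
    moreover have "k * l $ r = - (1 + \<bar>p + l \<bullet> (b - A *v x)\<bar>)"
      using neg by (simp add: k_def)
    ultimately show False by linarith
  qed
  have lim: "0 \<le> p * (c \<bullet> (y - x)) + l \<bullet> (b - A *v y)" if y: "y \<in> C" for y
  proof (rule field_le_epsilon)
    fix e :: real assume e: "0 < e"
    have "0 \<le> p * (c \<bullet> (y - x) + e / (p + 1)) + l \<bullet> (b - A *v y)"
      using sep[OF y, of "c \<bullet> (y - x) + e / (p + 1)" "b - A *v y"] e p0 by (simp add: divide_pos_pos)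
    moreover have "p * (e / (p + 1)) \<le> e" using e p0 by (simp add: field_simps)
    ultimately show "0 \<le> p * (c \<bullet> (y - x)) + l \<bullet> (b - A *v y) + e"
      by (simp add: distrib_left)
  qed
  \<comment> \<open>Otherwise a nonzero nonnegative \<open>l\<close> alone would separate, against strict feasibility of \<open>x0\<close>.\<close>
  have "p \<noteq> 0"
  proof
    assume p: "p = 0"
    then have "l \<noteq> 0" using a(1) pl by (auto simp: zero_prod_def)
    then obtain r where r: "l $ r \<noteq> 0" by (auto simp: vec_eq_iff)
    have "0 < l \<bullet> (A *v x0 - b)"
      unfolding inner_vec_def
    proof (rule sum_pos2[of _ r])
      show "0 < l $ r \<bullet> (A *v x0 - b) $ r"
        using r l0 slater(2)[of r] by (simp add: less_eq_vec_def order_less_le)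
      show "0 \<le> l $ i \<bullet> (A *v x0 - b) $ i" for i
        using l0 slater(2)[of i] by (simp add: less_eq_vec_def)
    qed auto
    with lim[OF slater(1)] p show False by (simp add: inner_diff_right)
  qed
  with p0 have p: "0 < p" by simp
  define \<mu> where "\<mu> = (1 / p) *\<^sub>R l"
  have \<mu>0: "0 \<le> \<mu>" using l0 p by (simp add: \<mu>_def less_eq_vec_def)
  have lagr: "0 \<le> c \<bullet> (y - x) + \<mu> \<bullet> (b - A *v y)" if "y \<in> C" for y
  proof -
    have "p * (c \<bullet> (y - x) + \<mu> \<bullet> (b - A *v y)) = p * (c \<bullet> (y - x)) + l \<bullet> (b - A *v y)"
      using p by (simp add: \<mu>_def distrib_left)
    with lim[OF that] p show ?thesis by (metis zero_le_mult_iff not_le)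
  qed
  have "0 \<le> \<mu> \<bullet> (A *v x - b)"
    unfolding inner_vec_def using \<mu>0 x(2) by (intro sum_nonneg) (auto simp: less_eq_vec_def)
  moreover have "0 \<le> \<mu> \<bullet> (b - A *v x)" using lagr[OF x(1)] by simp
  ultimately have comp: "\<mu> \<bullet> (A *v x - b) = 0" by (simp add: inner_diff_right)
  have "0 \<le> (c - transpose A *v \<mu>) \<bullet> (y - x)" if "y \<in> C" for y
  proof -
    have "(transpose A *v \<mu>) \<bullet> (y - x) = \<mu> \<bullet> (A *v y) - \<mu> \<bullet> (A *v x)"
      by (simp add: dot_lmul_matrix[symmetric] inner_diff_right)
    then show ?thesis
      using lagr[OF that] comp by (simp add: inner_diff_left inner_diff_right)
  qed
  with \<mu>0 comp show ?thesis by blast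
qed

text \<open>
  An interior point of the feasible set satisfies strictly every constraint with a nonzero row. A zero
  row can only express a vacuous constraint, possibly with equality; lowering its right-hand side by
  one keeps the feasible set and restores the Slater condition.
\<close>

lemma linear_constraint_multiplier:
  fixes A :: "real^'n::finite^'m::finite"
  assumes C: "convex C" and x: "x \<in> C" "b \<le> A *v x"
    and opt: "\<And>y. y \<in> C \<Longrightarrow> b \<le> A *v y \<Longrightarrow> 0 \<le> c \<bullet> (y - x)"
    and int: "interior (C \<inter> {y. b \<le> A *v y}) \<noteq> {}"
  shows "\<exists>l. 0 \<le> l \<and> l \<bullet> (A *v x - b) = 0 \<and> (\<forall>y\<in>C. 0 \<le> (c - transpose A *v l) \<bullet> (y - x))"
proof -
  define b' where "b' = (\<chi> r. if row r A = 0 then b $ r - 1 else b $ r)"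
  have zero_row: "(A *v y) $ r = 0" if "row r A = 0" for y r
    using that by (simp add: matrix_vector_mult_def row_def vec_eq_iff)
  have b'_le: "b' \<le> b" by (simp add: b'_def less_eq_vec_def)
  have same: "b \<le> A *v y" if "b' \<le> A *v y" for y
    unfolding less_eq_vec_def
  proof
    fix r
    show "b $ r \<le> (A *v y) $ r"
      using that x(2) zero_row[of r x] zero_row[of r y]
      by (cases "row r A = 0") (auto simp: less_eq_vec_def b'_def split: if_splits, metis+)
  qed
  obtain x0 where x0: "x0 \<in> interior (C \<inter> {y. b \<le> A *v y})" using int by blast
  then obtain e where e: "0 < e" "ball x0 e \<subseteq> C \<inter> {y. b \<le> A *v y}"
    using mem_interior by blast
  have x0C: "x0 \<in> C" "b \<le> A *v x0" using e by (auto dest!: subsetD[of "ball x0 e" _ x0])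
  have strict: "b' $ r < (A *v x0) $ r" for r
  proof (cases "row r A = 0")
    case True
    then show ?thesis using x0C by (auto simp: b'_def less_eq_vec_def intro: less_le_trans[of _ "b $ r"])
  next
    case False
    \<comment> \<open>Moving from \<open>x0\<close> against the nonzero row stays feasible and strictly lowers that constraint.\<close>
    define h where "h = (e / 2 / norm (row r A)) *\<^sub>R row r A"
    have n: "0 < norm (row r A)" using False by simp
    have "norm h = e / 2" using e n by (simp add: h_def)
    then have "x0 - h \<in> ball x0 e" using e by (simp add: dist_norm)
    then have "b \<le> A *v (x0 - h)" using e(2) by blast
    then have "b $ r \<le> (A *v (x0 - h)) $ r" by (simp add: less_eq_vec_def)
    also have "\<dots> = (A *v x0) $ r - row r A \<bullet> h"
      by (simp add: matrix_vector_mul_component matrix_vector_mult_diff_distrib row_def vec_nth_inverse)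
    finally have "b $ r + row r A \<bullet> h \<le> (A *v x0) $ r" by simp
    moreover have "row r A \<bullet> h > 0" using e n by (simp add: h_def)
    ultimately show ?thesis using False by (simp add: b'_def)
  qed
  obtain l where l: "0 \<le> l" "l \<bullet> (A *v x - b') = 0"
      "\<forall>y\<in>C. 0 \<le> (c - transpose A *v l) \<bullet> (y - x)"
    using slater_multiplier[OF C x(1) order_trans[OF b'_le x(2)] opt[OF _ same] x0C(1) strict] by blast
  have "l \<bullet> (A *v x - b) \<le> l \<bullet> (A *v x - b')"
    unfolding inner_vec_def using l(1) b'_le
    by (intro sum_mono) (auto simp: less_eq_vec_def intro!: mult_left_mono)
  moreover have "0 \<le> l \<bullet> (A *v x - b)"
    unfolding inner_vec_def using l(1) x(2) by (intro sum_nonneg) (auto simp: less_eq_vec_def)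
  ultimately show ?thesis using l by (intro exI[of _ l]) auto
qed

section \<open>The graph Laplacian\<close>

text \<open>
  The matrix Laplacian of the weighted graph acting on vectors attached to the vertices, written with
  differences so that consensus vectors are visibly in its kernel.
\<close>

definition laplacian :: "real^'p^'p \<Rightarrow> 'a::real_vector^'p \<Rightarrow> 'a^'p::finite" where
  "laplacian W y = (\<chi> i. \<Sum>j\<in>UNIV. (W $ i $ j) *\<^sub>R (y $ i - y $ j))"

lemma linear_laplacian: "linear (laplacian W)"
  by (rule linearI)
    (simp_all add: laplacian_def vec_eq_iff sum.distrib[symmetric] scaleR_sum_right algebra_simps
      scaleR_right_diff_distrib cong: sum.cong)

lemma symmetric_matrix_entries:
  assumes "W = transpose W" shows "W $ i $ j = W $ j $ i"
  using arg_cong[OF assms, of "\<lambda>M. M $ i $ j"] by (simp add: transpose_def)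

text \<open>
  The Dirichlet form, from which symmetry, monotonicity and the kernel can be read off.
\<close>

lemma laplacian_inner:
  fixes y u :: "'a::real_inner^'p::finite"
  assumes sym: "W = transpose W"
  shows "2 * (laplacian W y \<bullet> u) = (\<Sum>i\<in>UNIV. \<Sum>j\<in>UNIV. W $ i $ j * ((y $ i - y $ j) \<bullet> (u $ i - u $ j)))"
proof -
  have 1: "laplacian W y \<bullet> u = (\<Sum>i\<in>UNIV. \<Sum>j\<in>UNIV. W $ i $ j * ((y $ i - y $ j) \<bullet> u $ i))"
    by (simp add: laplacian_def inner_vec_def inner_sum_left)
  have "laplacian W y \<bullet> u = (\<Sum>j\<in>UNIV. \<Sum>i\<in>UNIV. W $ i $ j * ((y $ i - y $ j) \<bullet> u $ i))"
    unfolding 1 by (rule sum.swap)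
  also have "\<dots> = (\<Sum>i\<in>UNIV. \<Sum>j\<in>UNIV. - (W $ i $ j * ((y $ i - y $ j) \<bullet> u $ j)))"
    using symmetric_matrix_entries[OF sym] by (intro sum.cong refl) (simp add: algebra_simps)
  finally have 2: "laplacian W y \<bullet> u = \<dots>" .
  have "2 * (laplacian W y \<bullet> u) = laplacian W y \<bullet> u + laplacian W y \<bullet> u" by simp
  also have "\<dots> = (\<Sum>i\<in>UNIV. \<Sum>j\<in>UNIV. W $ i $ j * ((y $ i - y $ j) \<bullet> u $ i)
      + - (W $ i $ j * ((y $ i - y $ j) \<bullet> u $ j)))"
    by (subst (2) 2, subst 1) (simp only: sum.distrib)
  also have "\<dots> = (\<Sum>i\<in>UNIV. \<Sum>j\<in>UNIV. W $ i $ j * ((y $ i - y $ j) \<bullet> (u $ i - u $ j)))"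
    by (intro sum.cong refl) (simp add: algebra_simps)
  finally show ?thesis .
qed

lemma laplacian_self_adjoint:
  fixes y u :: "'a::real_inner^'p::finite"
  assumes sym: "W = transpose W"
  shows "laplacian W y \<bullet> u = y \<bullet> laplacian W u"
proof -
  have "2 * (laplacian W y \<bullet> u) = 2 * (laplacian W u \<bullet> y)"
    unfolding laplacian_inner[OF sym] by (simp add: inner_commute)
  then show ?thesis by (simp add: inner_commute)
qed

text \<open>
  Cauchy-Schwarz at each vertex, with the weights split as square roots, bounds the square of a row by
  its degree times its share of the Dirichlet form.
\<close>

lemma laplacian_cocoercive:
  fixes y :: "'a::real_inner^'p::finite"
  assumes sym: "W = transpose W" and nn: "\<And>i j. 0 \<le> W $ i $ j"
    and deg: "\<And>i. weighted_degree W i \<le> d"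
  shows "(norm (laplacian W y))\<^sup>2 \<le> 2 * d * (laplacian W y \<bullet> y)"
proof -
  have deg0: "0 \<le> weighted_degree W i" for i
    unfolding weighted_degree_def using nn by (simp add: sum_nonneg)
  have row: "(norm (laplacian W y $ i))\<^sup>2 \<le> d * (\<Sum>j\<in>UNIV. W $ i $ j * (norm (y $ i - y $ j))\<^sup>2)" for i
  proof -
    have "norm (laplacian W y $ i) \<le> (\<Sum>j\<in>UNIV. W $ i $ j * norm (y $ i - y $ j))"
      using nn by (auto simp: laplacian_def intro!: order_trans[OF norm_sum])
    also have "\<dots> = (\<Sum>j\<in>UNIV. sqrt (W $ i $ j) * (sqrt (W $ i $ j) * norm (y $ i - y $ j)))"
      using nn by (simp add: mult.assoc[symmetric])
    finally have "(norm (laplacian W y $ i))\<^sup>2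
        \<le> (\<Sum>j\<in>UNIV. sqrt (W $ i $ j) * (sqrt (W $ i $ j) * norm (y $ i - y $ j)))\<^sup>2"
      by (intro power_mono) auto
    also have "\<dots> \<le> (\<Sum>j\<in>UNIV. (sqrt (W $ i $ j))\<^sup>2) * (\<Sum>j\<in>UNIV. (sqrt (W $ i $ j) * norm (y $ i - y $ j))\<^sup>2)"
      by (rule Cauchy_Schwarz_ineq_sum)
    also have "\<dots> = weighted_degree W i * (\<Sum>j\<in>UNIV. W $ i $ j * (norm (y $ i - y $ j))\<^sup>2)"
      using nn by (simp add: weighted_degree_def power_mult_distrib)
    also have "\<dots> \<le> d * (\<Sum>j\<in>UNIV. W $ i $ j * (norm (y $ i - y $ j))\<^sup>2)"
      using deg nn by (intro mult_right_mono sum_nonneg) auto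
    finally show ?thesis .
  qed
  have "(norm (laplacian W y))\<^sup>2 = (\<Sum>i\<in>UNIV. (norm (laplacian W y $ i))\<^sup>2)"
    by (simp add: power2_norm_eq_inner inner_vec_def)
  also have "\<dots> \<le> (\<Sum>i\<in>UNIV. d * (\<Sum>j\<in>UNIV. W $ i $ j * (norm (y $ i - y $ j))\<^sup>2))"
    using row by (intro sum_mono)
  also have "\<dots> = d * (2 * (laplacian W y \<bullet> y))"
    unfolding laplacian_inner[OF sym] by (simp add: sum_distrib_left power2_norm_eq_inner)
  finally show ?thesis by simp
qed

text \<open>
  A vanishing Dirichlet form means equality across every edge, and connectedness spreads it.
\<close>

lemma laplacian_kernel:
  fixes y :: "'a::real_inner^'p::finite"
  assumes W: "weighted_graph Nb W" "assumption3 Nb W" and y: "laplacian W y = 0"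
  shows "y $ i = y $ j"
proof -
  have nn: "0 \<le> W $ i $ j" for i j using W(1) by (metis order.refl order_less_imp_le weighted_graph_def)
  have sym: "W = transpose W" using W(2) by (simp add: assumption3_def)
  have "(\<Sum>i\<in>UNIV. \<Sum>j\<in>UNIV. W $ i $ j * ((y $ i - y $ j) \<bullet> (y $ i - y $ j))) = 0"
    using laplacian_inner[OF sym, of y y] y by simp
  then have "W $ p $ q * ((y $ p - y $ q) \<bullet> (y $ p - y $ q)) = 0" for p q
    using nn by (simp add: sum_nonneg_eq_0_iff sum_nonneg)
  moreover have "0 < W $ p $ q" if "q \<in> Nb p" for p q
    using W(1) that by (simp add: weighted_graph_def)
  ultimately have edge: "y $ p = y $ q" if "q \<in> Nb p" for p q
    using that by (metis inner_eq_zero_iff less_irrefl mult_eq_0_iff right_minus_eq)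
  have "(i, j) \<in> {(p, q). q \<in> Nb p}\<^sup>*" using W(2) unfolding assumption3_def by blast
  then show ?thesis by (induction rule: rtrancl_induct) (auto simp: edge)
qed

lemma sum_laplacian:
  assumes sym: "W = transpose W"
  shows "(\<Sum>i\<in>UNIV. laplacian W y $ i) = (0::'a::real_inner)"
proof -
  have "(\<Sum>i\<in>UNIV. laplacian W y $ i) \<bullet> v = 0" for v
    using laplacian_inner[OF sym, of y "\<chi> i. v"] by (simp add: inner_vec_def inner_sum_left)
  then show ?thesis by (metis inner_eq_zero_iff)
qed

text \<open>
  A self-adjoint map has the orthogonal complement of its kernel as range, and the kernel consists of
  the consensus vectors.
\<close>

lemma laplacian_solvable:
  fixes r :: "'a::euclidean_space^'p::finite"
  assumes W: "weighted_graph Nb W" "assumption3 Nb W" and r: "(\<Sum>i\<in>UNIV. r $ i) = 0"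
  shows "\<exists>y. laplacian W y = r"
proof -
  have sym: "W = transpose W" using W(2) by (simp add: assumption3_def)
  let ?R = "range (laplacian W :: 'a^'p \<Rightarrow> 'a^'p)"
  have sub: "subspace ?R"
    by (rule linear_subspace_image[OF linear_laplacian subspace_UNIV])
  then have span: "span ?R = ?R" by (simp add: span_eq_iff)
  obtain p q where pq: "p \<in> span ?R" "\<And>w. w \<in> span ?R \<Longrightarrow> orthogonal q w" "r = p + q"
    using orthogonal_subspace_decomp_exists[of ?R r] by blast
  \<comment> \<open>A vector orthogonal to the range of a self-adjoint map lies in its kernel.\<close>
  have "laplacian W q = 0"
  proof -
    have "laplacian W q \<bullet> laplacian W q = q \<bullet> laplacian W (laplacian W q)"
      by (rule laplacian_self_adjoint[OF sym])
    also have "\<dots> = 0" using pq(2) span by (auto simp: orthogonal_def)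
    finally show ?thesis by simp
  qed
  then obtain v where v: "\<And>i. q $ i = v" using laplacian_kernel[OF W] by metis
  have "q \<bullet> q = q \<bullet> r"
    using pq by (simp add: orthogonal_def inner_add_right inner_commute)
  also have "\<dots> = v \<bullet> (\<Sum>i\<in>UNIV. r $ i)" by (simp add: inner_vec_def v inner_sum_right)
  finally have "q = 0" using r by simp
  then show ?thesis using pq span by auto
qed

section \<open>Block structure of the game\<close>

lemma linear_block: "linear (block pl i)"
  by (rule linearI) (auto simp: block_def vec_eq_iff)

lemma block_in_player_space: "block pl i v \<in> player_space pl i"
  by (simp add: block_def player_space_def)

lemma inner_player_space:
  fixes g v :: "real^'n::finite"
  assumes "v \<in> player_space pl i" shows "g \<bullet> v = block pl i g \<bullet> v"
  unfolding inner_vec_def using assms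
  by (intro sum.cong) (auto simp: block_def player_space_def)

lemma sum_blocks:
  fixes v :: "real^'n::finite" and pl :: "'n \<Rightarrow> 'p::finite"
  shows "(\<Sum>i\<in>UNIV. block pl i v) = v"
  by (simp add: vec_eq_iff block_def)

lemma closed_joint_set:
  assumes "\<And>i. closed (\<Omega> i)" shows "closed (joint_set pl \<Omega>)"
proof -
  have "joint_set pl \<Omega> = (\<Inter>i. block pl i -` \<Omega> i)" by (auto simp: joint_set_def)
  moreover have "closed (block pl i -` \<Omega> i)" for i
    using assms linear_continuous_on[OF linear_block[unfolded linear_conv_bounded_linear], of UNIV pl i]
    by (simp add: continuous_closed_vimage linear_continuous_at linear_block linear_conv_bounded_linear[symmetric])
  ultimately show ?thesis by auto
qed

lemma convex_joint_set:
  assumes "\<And>i. convex (\<Omega> i)" shows "convex (joint_set pl \<Omega>)"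
proof -
  have "joint_set pl \<Omega> = (\<Inter>i. block pl i -` \<Omega> i)" by (auto simp: joint_set_def)
  then show ?thesis using assms by (simp add: convex_INT convex_linear_vimage linear_block)
qed

text \<open>
  Over a product of private sets a variational inequality decouples: one direction tests with
  unilateral deviations, the other adds up the players' inequalities.
\<close>

lemma joint_VI_iff_blockwise:
  fixes pl :: "'n::finite \<Rightarrow> 'p::finite"
  assumes \<Omega>: "\<And>i. \<Omega> i \<subseteq> player_space pl i" and x: "x \<in> joint_set pl \<Omega>"
  shows "(\<forall>y\<in>joint_set pl \<Omega>. 0 \<le> g \<bullet> (y - x)) \<longleftrightarrow>
    (\<forall>i. \<forall>y\<in>\<Omega> i. 0 \<le> block pl i g \<bullet> (y - block pl i x))"
proof (intro iffI allI ballI)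
  fix i y assume joint: "\<forall>y\<in>joint_set pl \<Omega>. 0 \<le> g \<bullet> (y - x)" and y: "y \<in> \<Omega> i"
  have y_sp: "y \<in> player_space pl i" using y \<Omega> by blast
  \<comment> \<open>The unilateral deviation of player \<open>i\<close> to \<open>y\<close> is a competitor in the joint inequality.\<close>
  have "block pl j (with_block pl i y x) = (if j = i then y else block pl j x)" for j
    using y_sp by (auto simp: block_def with_block_def player_space_def vec_eq_iff)
  then have "with_block pl i y x \<in> joint_set pl \<Omega>"
    using x y by (simp add: joint_set_def)
  moreover have "with_block pl i y x - x = y - block pl i x"
    using y_sp by (auto simp: block_def with_block_def player_space_def vec_eq_iff)
  ultimately have "0 \<le> g \<bullet> (y - block pl i x)" using joint by metis
  moreover have "y - block pl i x \<in> player_space pl i"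
    using y_sp by (simp add: player_space_def block_def)
  ultimately show "0 \<le> block pl i g \<bullet> (y - block pl i x)"
    using inner_player_space by metis
next
  fix y assume bw: "\<forall>i. \<forall>y\<in>\<Omega> i. 0 \<le> block pl i g \<bullet> (y - block pl i x)" and y: "y \<in> joint_set pl \<Omega>"
  have "g \<bullet> (y - x) = (\<Sum>i\<in>UNIV. g \<bullet> block pl i (y - x))"
    by (simp add: inner_sum_right[symmetric] sum_blocks)
  also have "\<dots> = (\<Sum>i\<in>UNIV. block pl i g \<bullet> (block pl i y - block pl i x))"
    by (intro sum.cong refl)
       (metis inner_player_space[OF block_in_player_space] linear_diff[OF linear_block])
  also have "\<dots> \<ge> 0" using bw y by (intro sum_nonneg) (auto simp: joint_set_def)
  finally show "0 \<le> g \<bullet> (y - x)" .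
qed

text \<open>
  Moving a coordinate of another player leaves the differentiated function unchanged.
\<close>

lemma partial_gradient_player_space:
  assumes "(\<lambda>y. g (with_block pl i y x)) differentiable (at x)"
  shows "partial_gradient pl i g x \<in> player_space pl i"
proof -
  let ?h = "\<lambda>y. g (with_block pl i y x)"
  obtain h' where h': "(?h has_derivative h') (at x)" using assms by (auto simp: differentiable_def)
  then have lin: "linear h'" by (rule has_derivative_linear)
  have rep: "h' v = v \<bullet> adjoint h' 1" for v
    using adjoint_works[OF lin, of v 1] by simp
  then have D: "GDERIV ?h x :> adjoint h' 1"
    unfolding gderiv_def using h' by (simp add: rep[symmetric])
  have "partial_gradient pl i g x = adjoint h' 1"
    unfolding partial_gradient_def
  proof (rule the_equality)
    show "GDERIV ?h x :> adjoint h' 1" by (rule D)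
    fix D' assume "GDERIV ?h x :> D'"
    then have "(\<lambda>v. v \<bullet> D') = (\<lambda>v. v \<bullet> adjoint h' 1)"
      using D unfolding gderiv_def by (rule has_derivative_unique)
    then have "\<forall>v. v \<bullet> D' = v \<bullet> adjoint h' 1"
      by (intro allI) (erule fun_cong)
    then show "D' = adjoint h' 1" by (simp only: vector_eq_ldot)
  qed
  moreover have "adjoint h' 1 \<in> player_space pl i"
    unfolding player_space_def
  proof (intro CollectI allI impI)
    fix j assume j: "pl j \<noteq> i"
    \<comment> \<open>Along coordinate \<open>j\<close> the function is constant, so its derivative vanishes in that direction.\<close>
    have "((\<lambda>t. ?h (x + t *\<^sub>R axis j 1)) has_derivative (\<lambda>t. h' (t *\<^sub>R axis j 1))) (at 0)"
      by (rule has_derivative_compose[of "\<lambda>t. x + t *\<^sub>R axis j 1" "\<lambda>t. t *\<^sub>R axis j 1" 0 UNIV ?h h'])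
         (use h' in \<open>auto intro!: derivative_eq_intros\<close>)
    moreover have "with_block pl i (x + t *\<^sub>R axis j 1) x = x" for t
      using j by (auto simp: with_block_def axis_def vec_eq_iff)
    ultimately have "((\<lambda>t. g x) has_derivative (\<lambda>t. h' (t *\<^sub>R axis j 1))) (at (0::real))" by simp
    then have "(\<lambda>t::real. h' (t *\<^sub>R axis j 1)) = (\<lambda>t. 0)"
      using has_derivative_unique has_derivative_const by blast
    from fun_cong[OF this, of 1] show "adjoint h' 1 $ j = 0"
      by (simp add: rep inner_axis' )
  qed
  ultimately show ?thesis by simp
qed

lemma block_pseudo_gradient:
  assumes "(\<lambda>y. f i (with_block pl i y x)) differentiable (at x)"
  shows "block pl i (pseudo_gradient pl f x) = partial_gradient pl i (f i) x"
  using partial_gradient_player_space[of "f i", OF assms]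
  by (auto simp: block_def pseudo_gradient_def player_space_def vec_eq_iff)

section \<open>The KKT conditions as variational inequalities\<close>

lemma nonneg_orthant_eq: "nonneg_orthant = (\<Inter>r. {l. 0 \<le> l $ r})"
  by (auto simp: nonneg_orthant_def less_eq_vec_def)

lemma closed_nonneg_orthant: "closed (nonneg_orthant :: (real^'m::finite) set)"
  unfolding nonneg_orthant_eq
  by (intro closed_INT ballI closed_Collect_le continuous_intros)

lemma convex_nonneg_orthant: "convex (nonneg_orthant :: (real^'m::finite) set)"
  by (auto simp: nonneg_orthant_def convex_def less_eq_vec_def)

lemma inner_nonneg_vec:
  fixes a b :: "real^'m::finite"
  assumes "0 \<le> a" "0 \<le> b" shows "0 \<le> a \<bullet> b"
  unfolding inner_vec_def using assms by (intro sum_nonneg) (simp add: less_eq_vec_def)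

lemma complementarity_iff_orthant_VI:
  fixes l g :: "real^'m::finite"
  assumes l: "0 \<le> l"
  shows "(\<forall>y\<ge>0. 0 \<le> g \<bullet> (y - l)) \<longleftrightarrow> 0 \<le> g \<and> l \<bullet> g = 0"
proof
  assume VI: "\<forall>y\<ge>0. 0 \<le> g \<bullet> (y - l)"
  have "0 \<le> g"
    unfolding less_eq_vec_def
  proof
    fix r
    have "0 \<le> l + axis r 1" using l by (simp add: less_eq_vec_def axis_def)
    with VI have "0 \<le> g \<bullet> (l + axis r 1 - l)" by blast
    then show "0 $ r \<le> g $ r" by (simp add: inner_axis)
  qed
  moreover have "0 \<le> 2 *\<^sub>R l" using l by (simp add: less_eq_vec_def)
  with VI have "0 \<le> g \<bullet> (2 *\<^sub>R l - l)" "0 \<le> g \<bullet> (0 - l)" by blast+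
  then have "l \<bullet> g = 0" by (simp add: inner_commute scaleR_2)
  ultimately show "0 \<le> g \<and> l \<bullet> g = 0" by blast
next
  assume "0 \<le> g \<and> l \<bullet> g = 0"
  then show "\<forall>y\<ge>0. 0 \<le> g \<bullet> (y - l)"
    using inner_nonneg_vec[of g] by (simp add: inner_diff_right inner_commute[of l])
qed

text \<open>
  The block diagonal matrix of all \<open>A\<^sub>i\<close>: each player sees only the own share of the constraint.
\<close>

definition stacked_constraint :: "('n \<Rightarrow> 'p) \<Rightarrow> real^'n^'m \<Rightarrow> real^'n::finite \<Rightarrow> (real^'m)^'p" where
  "stacked_constraint pl A x = (\<chi> i. column_block pl i A *v x)"

definition stacked_adjoint :: "('n \<Rightarrow> 'p) \<Rightarrow> real^'n^'m::finite \<Rightarrow> (real^'m)^'p \<Rightarrow> real^'n" where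
  "stacked_adjoint pl A l = (\<chi> j. \<Sum>r\<in>UNIV. A $ r $ j * l $ pl j $ r)"

lemma linear_stacked_constraint: "linear (stacked_constraint pl A)"
  by (rule linearI)
     (simp_all add: stacked_constraint_def vec_eq_iff matrix_vector_right_distrib
       matrix_vector_mult_scaleR)

lemma linear_stacked_adjoint: "linear (stacked_adjoint pl A)"
  by (rule linearI)
     (simp_all add: stacked_adjoint_def vec_eq_iff sum.distrib[symmetric] sum_distrib_left algebra_simps)

lemma stacked_adjoint_works:
  fixes pl :: "'n::finite \<Rightarrow> 'p::finite"
  shows "stacked_constraint pl A x \<bullet> l = x \<bullet> stacked_adjoint pl A l"
proof -
  have "stacked_constraint pl A x \<bullet> l
     = (\<Sum>i\<in>UNIV. \<Sum>r\<in>UNIV. \<Sum>j\<in>UNIV. if pl j = i then A $ r $ j * x $ j * l $ i $ r else 0)"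
    by (simp add: stacked_constraint_def inner_vec_def matrix_vector_mult_def column_block_def
        sum_distrib_right if_distrib[of "\<lambda>a. a * _"] cong: if_cong)
  also have "\<dots> = (\<Sum>j\<in>UNIV. \<Sum>r\<in>UNIV. \<Sum>i\<in>UNIV. if pl j = i then A $ r $ j * x $ j * l $ i $ r else 0)"
    by (subst sum.swap, subst (2) sum.swap, subst sum.swap) simp
  also have "\<dots> = x \<bullet> stacked_adjoint pl A l"
    by (simp add: stacked_adjoint_def inner_vec_def sum_distrib_left mult_ac)
  finally show ?thesis .
qed

lemma column_block_mult_block: "column_block pl i A *v block pl i x = column_block pl i A *v x"
  by (auto simp: column_block_def block_def matrix_vector_mult_def vec_eq_iff intro!: sum.cong)

lemma sum_stacked_constraint:
  fixes pl :: "'n::finite \<Rightarrow> 'p::finite"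
  shows "(\<Sum>i\<in>UNIV. stacked_constraint pl A x $ i) = A *v x"
proof -
  have "(\<Sum>i\<in>UNIV. column_block pl i A) = A"
    by (simp add: vec_eq_iff column_block_def)
  then show ?thesis
    by (simp add: stacked_constraint_def matrix_vector_mult_def vec_eq_iff sum_distrib_right
        sum.swap[of _ UNIV "UNIV :: 'p set"] column_block_def if_distrib[of "\<lambda>a. a * _"] cong: if_cong)
qed

lemma block_stacked_adjoint:
  "block pl i (stacked_adjoint pl A l) = transpose (column_block pl i A) *v (l $ i)"
  by (simp add: block_def stacked_adjoint_def matrix_vector_mult_def transpose_def column_block_def vec_eq_iff)

lemma stacked_adjoint_consensus: "stacked_adjoint pl A (\<chi> i. l) = transpose A *v l"
  by (simp add: stacked_adjoint_def matrix_vector_mult_def transpose_def vec_eq_iff)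

text \<open>
  Restates the inclusions with normal cones as two variational inequalities, the form in which the
  multiplier argument and the primal-dual iteration meet.
\<close>

lemma KKT_iff:
  fixes pl :: "'n::finite \<Rightarrow> 'p::finite"
  assumes \<Omega>: "\<And>i. \<Omega> i \<subseteq> player_space pl i"
    and diff: "\<And>i. (\<lambda>y. f i (with_block pl i y x)) differentiable (at x)"
  shows "KKT pl f \<Omega> A b x l \<longleftrightarrow>
    x \<in> joint_set pl \<Omega> \<and> 0 \<le> l \<and>
    (\<forall>y\<in>joint_set pl \<Omega>. 0 \<le> (pseudo_gradient pl f x - transpose A *v l) \<bullet> (y - x)) \<and>
    (\<forall>y\<ge>0. 0 \<le> (A *v x - b) \<bullet> (y - l))"
proof -
  define g where "g i = partial_gradient pl i (f i) x - transpose (column_block pl i A) *v l" for i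
  have g: "block pl i (pseudo_gradient pl f x - transpose A *v l) = g i" for i
    using block_stacked_adjoint[of pl i A "\<chi> i. l"]
    by (simp add: linear_diff[OF linear_block] block_pseudo_gradient[of f, OF diff]
        stacked_adjoint_consensus g_def)
  have g_sp: "- g i \<in> player_space pl i" for i
    using block_in_player_space[of pl i "pseudo_gradient pl f x - transpose A *v l"]
    unfolding g by (simp add: player_space_def)
  have "(\<exists>v \<in> normal_cone_in (player_space pl i) (\<Omega> i) (block pl i x). 0 = g i + v)
      \<longleftrightarrow> block pl i x \<in> \<Omega> i \<and> (\<forall>y\<in>\<Omega> i. 0 \<le> g i \<bullet> (y - block pl i x))" for i
  proof -
    have "0 = g i + v \<longleftrightarrow> v = - g i" for v by (metis add_eq_0_iff)
    then show ?thesis using g_sp[of i] by (auto simp: normal_cone_in_def)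
  qed
  moreover have "(\<exists>v \<in> normal_cone_in UNIV nonneg_orthant l. 0 = (A *v x - b) + v)
      \<longleftrightarrow> 0 \<le> l \<and> (\<forall>y\<ge>0. 0 \<le> (A *v x - b) \<bullet> (y - l))"
  proof -
    have "0 = (A *v x - b) + v \<longleftrightarrow> v = - (A *v x - b)" for v
      by (metis add_eq_0_iff)
    then show ?thesis by (auto simp: normal_cone_in_def nonneg_orthant_def simp del: minus_diff_eq)
  qed
  ultimately have "KKT pl f \<Omega> A b x l \<longleftrightarrow>
      (\<forall>i. block pl i x \<in> \<Omega> i \<and> (\<forall>y\<in>\<Omega> i. 0 \<le> g i \<bullet> (y - block pl i x))) \<and>
      0 \<le> l \<and> (\<forall>y\<ge>0. 0 \<le> (A *v x - b) \<bullet> (y - l))"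
    unfolding KKT_def g_def[symmetric] by blast
  then show ?thesis
    using joint_VI_iff_blockwise[OF \<Omega>, of x "pseudo_gradient pl f x - transpose A *v l"]
    unfolding g joint_set_def by auto
qed

lemma KKT_imp_VI_solution:
  fixes pl :: "'n::finite \<Rightarrow> 'p::finite"
  assumes \<Omega>: "\<And>i. \<Omega> i \<subseteq> player_space pl i"
    and diff: "\<And>i. (\<lambda>y. f i (with_block pl i y x)) differentiable (at x)"
    and KKT: "KKT pl f \<Omega> A b x l"
  shows "VI_solution (pseudo_gradient pl f) (feasible_set pl \<Omega> A b) x"
proof -
  have x: "x \<in> joint_set pl \<Omega>" and l: "0 \<le> l"
    and st: "\<And>y. y \<in> joint_set pl \<Omega> \<Longrightarrow> 0 \<le> (pseudo_gradient pl f x - transpose A *v l) \<bullet> (y - x)"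
    and co: "0 \<le> A *v x - b" "l \<bullet> (A *v x - b) = 0"
    using KKT complementarity_iff_orthant_VI[of l "A *v x - b"] unfolding KKT_iff[of \<Omega> pl f, OF \<Omega> diff]
    by auto
  show ?thesis
    unfolding VI_solution_def feasible_set_def
  proof (intro conjI ballI)
    show "x \<in> joint_set pl \<Omega> \<inter> {x. b \<le> A *v x}" using x co by simp
    fix y assume y: "y \<in> joint_set pl \<Omega> \<inter> {x. b \<le> A *v x}"
    have "0 \<le> l \<bullet> (A *v y - b)" using inner_nonneg_vec[OF l, of "A *v y - b"] y by simp
    also have "\<dots> = (transpose A *v l) \<bullet> (y - x)"
      using co(2) by (simp add: dot_lmul_matrix inner_diff_right)
    also have "\<dots> \<le> pseudo_gradient pl f x \<bullet> (y - x)" using st[of y] y by (simp add: inner_diff_left)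
    finally show "0 \<le> pseudo_gradient pl f x \<bullet> (y - x)" .
  qed
qed

lemma VI_solution_imp_KKT:
  fixes pl :: "'n::finite \<Rightarrow> 'p::finite"
  assumes \<Omega>: "\<And>i. \<Omega> i \<subseteq> player_space pl i" "\<And>i. convex (\<Omega> i)"
    and diff: "\<And>i. (\<lambda>y. f i (with_block pl i y x)) differentiable (at x)"
    and int: "interior (feasible_set pl \<Omega> A b) \<noteq> {}"
    and VI: "VI_solution (pseudo_gradient pl f) (feasible_set pl \<Omega> A b) x"
  shows "\<exists>l. KKT pl f \<Omega> A b x l"
proof -
  have x: "x \<in> joint_set pl \<Omega>" "b \<le> A *v x"
    using VI by (auto simp: VI_solution_def feasible_set_def)
  have "0 \<le> pseudo_gradient pl f x \<bullet> (y - x)" if "y \<in> joint_set pl \<Omega>" "b \<le> A *v y" for y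
    using VI that by (auto simp: VI_solution_def feasible_set_def)
  from linear_constraint_multiplier[OF convex_joint_set[of \<Omega>, OF \<Omega>(2)] x this int[unfolded feasible_set_def]]
  obtain l where "0 \<le> l" "l \<bullet> (A *v x - b) = 0"
    "\<forall>y\<in>joint_set pl \<Omega>. 0 \<le> (pseudo_gradient pl f x - transpose A *v l) \<bullet> (y - x)"
    by blast
  then have "KKT pl f \<Omega> A b x l"
    unfolding KKT_iff[of \<Omega> pl f, OF \<Omega>(1) diff] using x complementarity_iff_orthant_VI[of l "A *v x - b"] by simp
  then show ?thesis by blast
qed

section \<open>The primal-dual operator splitting\<close>

type_synonym ('n, 'm, 'p) pd_point = "(real^'n) \<times> ((real^'m)^'p) \<times> ((real^'m)^'p)"

text \<open>
  The next four definitions cast the algorithm as one preconditioned forward-backward iteration on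
  triples \<open>(x, z, l)\<close>: the constraint set, the skew coupling treated implicitly, the cocoercive part
  treated explicitly, and the preconditioner. The off-diagonal entries of the preconditioner
  cancel the implicit couplings in the first two components, so that \<open>x\<close> and \<open>z\<close> can be updated from
  old values, and the multipliers afterwards from the new \<open>x\<close> and \<open>z\<close>.
\<close>

definition pd_set :: "('n \<Rightarrow> 'p) \<Rightarrow> ('p \<Rightarrow> (real^'n) set) \<Rightarrow> ('n::finite, 'm::finite, 'p::finite) pd_point set" where
  "pd_set pl \<Omega> = joint_set pl \<Omega> \<times> UNIV \<times> {l. \<forall>i. 0 \<le> l $ i}"

definition pd_skew :: "('n \<Rightarrow> 'p) \<Rightarrow> real^'n^'m \<Rightarrow> real^'p^'p
    \<Rightarrow> ('n::finite, 'm::finite, 'p::finite) pd_point \<Rightarrow> ('n, 'm, 'p) pd_point" where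
  "pd_skew pl A W = (\<lambda>(x, z, l).
     (- stacked_adjoint pl A l, - laplacian W l, stacked_constraint pl A x + laplacian W z))"

definition pd_smooth :: "(real^'n \<Rightarrow> real^'n) \<Rightarrow> real^'p^'p \<Rightarrow> ('p \<Rightarrow> real^'m)
    \<Rightarrow> ('n::finite, 'm::finite, 'p::finite) pd_point \<Rightarrow> ('n, 'm, 'p) pd_point" where
  "pd_smooth F W bs = (\<lambda>(x, z, l). (F x, 0, laplacian W l - (\<chi> i. bs i)))"

definition pd_metric :: "('n \<Rightarrow> 'p) \<Rightarrow> real^'n^'m \<Rightarrow> real^'p^'p
    \<Rightarrow> ('p \<Rightarrow> real) \<Rightarrow> ('p \<Rightarrow> real) \<Rightarrow> ('p \<Rightarrow> real)
    \<Rightarrow> ('n::finite, 'm::finite, 'p::finite) pd_point \<Rightarrow> ('n, 'm, 'p) pd_point" where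
  "pd_metric pl A W \<tau> \<nu> \<sigma> = (\<lambda>(x, z, l).
     ((\<chi> j. x $ j / \<tau> (pl j)) + stacked_adjoint pl A l,
      (\<chi> i. (1 / \<nu> i) *\<^sub>R z $ i) + laplacian W l,
      (\<chi> i. (1 / \<sigma> i) *\<^sub>R l $ i) + stacked_constraint pl A x + laplacian W z))"

lemma linear_pd_skew: "linear (pd_skew pl A W)"
  by (rule linearI)
     (auto simp: pd_skew_def linear_add[OF linear_stacked_adjoint] linear_add[OF linear_laplacian]
       linear_add[OF linear_stacked_constraint] linear_scale[OF linear_stacked_adjoint]
       linear_scale[OF linear_laplacian] linear_scale[OF linear_stacked_constraint] algebra_simps)

lemma linear_pd_metric: "linear (pd_metric pl A W \<tau> \<nu> \<sigma>)"
proof (rule linearI)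
  fix u v show "pd_metric pl A W \<tau> \<nu> \<sigma> (u + v) = pd_metric pl A W \<tau> \<nu> \<sigma> u + pd_metric pl A W \<tau> \<nu> \<sigma> v"
    by (auto simp: pd_metric_def split_beta linear_add[OF linear_stacked_adjoint]
        linear_add[OF linear_laplacian] linear_add[OF linear_stacked_constraint]
        vec_eq_iff add_divide_distrib distrib_left)
  fix c show "pd_metric pl A W \<tau> \<nu> \<sigma> (c *\<^sub>R u) = c *\<^sub>R pd_metric pl A W \<tau> \<nu> \<sigma> u"
    by (auto simp: pd_metric_def split_beta linear_scale[OF linear_stacked_adjoint]
        linear_scale[OF linear_laplacian] linear_scale[OF linear_stacked_constraint]
        vec_eq_iff distrib_left)
qed

lemma pd_skew_inner:
  fixes pl :: "'n::finite \<Rightarrow> 'p::finite"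
  assumes "W = transpose W" shows "pd_skew pl A W u \<bullet> u = 0"
proof -
  obtain x z l where u: "u = (x, z, l)" by (cases u) auto
  have "laplacian W z \<bullet> l = laplacian W l \<bullet> z"
    unfolding laplacian_self_adjoint[OF assms, of z l] by (rule inner_commute)
  then show ?thesis
    using stacked_adjoint_works[of pl A x l]
    by (simp add: u pd_skew_def inner_prod_def inner_add_left inner_commute[of x])
qed

lemma pd_metric_self_adjoint:
  fixes pl :: "'n::finite \<Rightarrow> 'p::finite"
  assumes W: "W = transpose W"
  shows "pd_metric pl A W \<tau> \<nu> \<sigma> u \<bullet> v = u \<bullet> pd_metric pl A W \<tau> \<nu> \<sigma> v"
proof -
  obtain x z l where u: "u = (x, z, l)" by (cases u) auto
  obtain x' z' l' where v: "v = (x', z', l')" by (cases v) auto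
  have "(\<chi> j. x $ j / \<tau> (pl j)) \<bullet> x' = x \<bullet> (\<chi> j. x' $ j / \<tau> (pl j))"
    "(\<chi> i. (1 / \<nu> i) *\<^sub>R z $ i) \<bullet> z' = z \<bullet> (\<chi> i. (1 / \<nu> i) *\<^sub>R z' $ i)"
    "(\<chi> i. (1 / \<sigma> i) *\<^sub>R l $ i) \<bullet> l' = l \<bullet> (\<chi> i. (1 / \<sigma> i) *\<^sub>R l' $ i)"
    by (simp_all add: inner_vec_def)
  then show ?thesis
    using stacked_adjoint_works[of pl A x l'] stacked_adjoint_works[of pl A x' l]
      laplacian_self_adjoint[OF W, of l z'] laplacian_self_adjoint[OF W, of z l']
    by (simp add: u v pd_metric_def inner_prod_def inner_add_left inner_add_right
        inner_commute[of "stacked_adjoint pl A l"] inner_commute[of l "stacked_constraint pl A x'"])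
qed

text \<open>
  Young's inequality on each entry of \<open>A\<close> splits the coupling into absolute column sums, charged to
  \<open>x\<close>, and absolute row sums within a player's columns, charged to the multipliers.
\<close>

lemma stacked_constraint_coupling:
  fixes pl :: "'n::finite \<Rightarrow> 'p::finite"
  shows "- (2 * (stacked_constraint pl A x \<bullet> l)) \<le>
    (\<Sum>j\<in>UNIV. (\<Sum>r\<in>UNIV. \<bar>A $ r $ j\<bar>) * (x $ j)\<^sup>2) +
    (\<Sum>i\<in>UNIV. \<Sum>r\<in>UNIV. (\<Sum>j | pl j = i. \<bar>A $ r $ j\<bar>) * (l $ i $ r)\<^sup>2)"
proof -
  have young: "- (2 * (x $ j * (A $ r $ j * l $ pl j $ r)))
      \<le> \<bar>A $ r $ j\<bar> * (x $ j)\<^sup>2 + \<bar>A $ r $ j\<bar> * (l $ pl j $ r)\<^sup>2" for j r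
  proof -
    have "- (2 * (x $ j * (A $ r $ j * l $ pl j $ r))) \<le> \<bar>A $ r $ j\<bar> * (2 * \<bar>x $ j\<bar> * \<bar>l $ pl j $ r\<bar>)"
      using abs_ge_minus_self[of "2 * (x $ j * (A $ r $ j * l $ pl j $ r))"] by (simp add: abs_mult mult_ac)
    also have "\<dots> \<le> \<bar>A $ r $ j\<bar> * ((x $ j)\<^sup>2 + (l $ pl j $ r)\<^sup>2)"
      using sum_squares_bound[of "\<bar>x $ j\<bar>" "\<bar>l $ pl j $ r\<bar>"] by (intro mult_left_mono) auto
    finally show ?thesis by (simp add: distrib_left)
  qed
  have "- (2 * (stacked_constraint pl A x \<bullet> l))
      = (\<Sum>j\<in>UNIV. \<Sum>r\<in>UNIV. - (2 * (x $ j * (A $ r $ j * l $ pl j $ r))))"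
    unfolding stacked_adjoint_works
    by (simp add: inner_vec_def stacked_adjoint_def sum_distrib_left sum_negf)
  also have "\<dots> \<le> (\<Sum>j\<in>UNIV. \<Sum>r\<in>UNIV. \<bar>A $ r $ j\<bar> * (x $ j)\<^sup>2 + \<bar>A $ r $ j\<bar> * (l $ pl j $ r)\<^sup>2)"
    by (intro sum_mono young)
  also have "\<dots> = (\<Sum>j\<in>UNIV. (\<Sum>r\<in>UNIV. \<bar>A $ r $ j\<bar>) * (x $ j)\<^sup>2)
      + (\<Sum>j\<in>UNIV. \<Sum>r\<in>UNIV. \<bar>A $ r $ j\<bar> * (l $ pl j $ r)\<^sup>2)"
    by (simp add: sum.distrib sum_distrib_right)
  also have "(\<Sum>j\<in>UNIV. \<Sum>r\<in>UNIV. \<bar>A $ r $ j\<bar> * (l $ pl j $ r)\<^sup>2)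
      = (\<Sum>i\<in>UNIV. \<Sum>j | pl j = i. \<Sum>r\<in>UNIV. \<bar>A $ r $ j\<bar> * (l $ pl j $ r)\<^sup>2)"
    using sum.group[of UNIV UNIV pl "\<lambda>j. \<Sum>r\<in>UNIV. \<bar>A $ r $ j\<bar> * (l $ pl j $ r)\<^sup>2"] by simp
  also have "\<dots> = (\<Sum>i\<in>UNIV. \<Sum>r\<in>UNIV. (\<Sum>j | pl j = i. \<bar>A $ r $ j\<bar>) * (l $ i $ r)\<^sup>2)"
    by (intro sum.cong refl) (subst sum.swap, simp add: sum_distrib_right)
  finally show ?thesis .
qed

text \<open>
  Young's inequality on each edge; by symmetry of the weights both endpoints are charged with their
  degree, whence the factor two.
\<close>

lemma laplacian_coupling:
  fixes z l :: "'a::real_inner^'p::finite"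
  assumes sym: "W = transpose W" and nn: "\<And>i j. 0 \<le> W $ i $ j"
  shows "- (2 * (laplacian W z \<bullet> l)) \<le>
    (\<Sum>i\<in>UNIV. 2 * weighted_degree W i * (norm (z $ i))\<^sup>2) +
    (\<Sum>i\<in>UNIV. 2 * weighted_degree W i * (norm (l $ i))\<^sup>2)"
proof -
  have young: "- (2 * (a \<bullet> b)) \<le> (norm a)\<^sup>2 + (norm b)\<^sup>2" "2 * (a \<bullet> b) \<le> (norm a)\<^sup>2 + (norm b)\<^sup>2"
    for a b :: 'a
  proof -
    have "0 \<le> (norm (a + b))\<^sup>2" "0 \<le> (norm (a - b))\<^sup>2" by simp_all
    then show "- (2 * (a \<bullet> b)) \<le> (norm a)\<^sup>2 + (norm b)\<^sup>2" "2 * (a \<bullet> b) \<le> (norm a)\<^sup>2 + (norm b)\<^sup>2"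
      unfolding power2_norm_eq_inner by (simp_all add: algebra_simps inner_commute)
  qed
  have "- (2 * (laplacian W z \<bullet> l))
      = (\<Sum>i\<in>UNIV. \<Sum>j\<in>UNIV. W $ i $ j * (- (2 * (z $ i \<bullet> l $ i)) + 2 * (z $ j \<bullet> l $ i)))"
    by (simp add: laplacian_def inner_vec_def inner_sum_left sum_distrib_left sum_negf[symmetric]
        inner_diff_left algebra_simps)
  also have "\<dots> \<le> (\<Sum>i\<in>UNIV. \<Sum>j\<in>UNIV. W $ i $ j *
      (((norm (z $ i))\<^sup>2 + (norm (l $ i))\<^sup>2) + ((norm (z $ j))\<^sup>2 + (norm (l $ i))\<^sup>2)))"
    by (intro sum_mono mult_left_mono add_mono young nn)
  also have "\<dots> = (\<Sum>i\<in>UNIV. \<Sum>j\<in>UNIV. W $ i $ j * (norm (z $ i))\<^sup>2)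
      + (\<Sum>i\<in>UNIV. \<Sum>j\<in>UNIV. W $ i $ j * (norm (z $ j))\<^sup>2)
      + (\<Sum>i\<in>UNIV. 2 * weighted_degree W i * (norm (l $ i))\<^sup>2)"
    by (simp add: distrib_left sum.distrib weighted_degree_def sum_distrib_right sum_distrib_left mult_ac
        flip: mult_2)
  also have "(\<Sum>i\<in>UNIV. \<Sum>j\<in>UNIV. W $ i $ j * (norm (z $ j))\<^sup>2)
      = (\<Sum>i\<in>UNIV. \<Sum>j\<in>UNIV. W $ i $ j * (norm (z $ i))\<^sup>2)"
    by (subst sum.swap) (simp add: symmetric_matrix_entries[OF sym])
  also have "(\<Sum>i\<in>UNIV. \<Sum>j\<in>UNIV. W $ i $ j * (norm (z $ i))\<^sup>2)
      = (\<Sum>i\<in>UNIV. weighted_degree W i * (norm (z $ i))\<^sup>2)"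
    by (simp add: weighted_degree_def sum_distrib_right)
  finally show ?thesis by (simp add: sum_distrib_left mult.assoc)
qed

text \<open>
  Diagonal dominance: the step-size bounds leave \<open>\<delta>\<close> in each coordinate after the couplings have
  been paid for.
\<close>

lemma pd_metric_elliptic:
  fixes pl :: "'n::finite \<Rightarrow> 'p::finite" and A :: "real^'n^'m::finite"
  assumes sym: "W = transpose W" and nn: "\<And>i j. 0 \<le> W $ i $ j"
    and \<tau>: "\<And>j. (\<Sum>r\<in>UNIV. \<bar>A $ r $ j\<bar>) + \<delta> \<le> 1 / \<tau> (pl j)"
    and \<nu>: "\<And>i. 2 * weighted_degree W i + \<delta> \<le> 1 / \<nu> i"
    and \<sigma>: "\<And>i r. (\<Sum>j | pl j = i. \<bar>A $ r $ j\<bar>) + 2 * weighted_degree W i + \<delta> \<le> 1 / \<sigma> i"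
  shows "\<delta> * (norm u)\<^sup>2 \<le> u \<bullet> pd_metric pl A W \<tau> \<nu> \<sigma> u"
proof -
  obtain x z l where u: "u = (x, z, l)" by (cases u) auto
  have x: "x \<bullet> (\<chi> j. x $ j / \<tau> (pl j)) \<ge>
      (\<Sum>j\<in>UNIV. (\<Sum>r\<in>UNIV. \<bar>A $ r $ j\<bar>) * (x $ j)\<^sup>2) + \<delta> * (norm x)\<^sup>2"
  proof -
    have nx: "(norm x)\<^sup>2 = (\<Sum>j\<in>UNIV. (x $ j)\<^sup>2)"
      unfolding power2_norm_eq_inner by (simp add: inner_vec_def power2_eq_square)
    have "(\<Sum>j\<in>UNIV. (\<Sum>r\<in>UNIV. \<bar>A $ r $ j\<bar>) * (x $ j)\<^sup>2) + \<delta> * (norm x)\<^sup>2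
       = (\<Sum>j\<in>UNIV. ((\<Sum>r\<in>UNIV. \<bar>A $ r $ j\<bar>) + \<delta>) * (x $ j)\<^sup>2)"
      unfolding nx by (simp add: distrib_right sum.distrib sum_distrib_left)
    also have "\<dots> \<le> (\<Sum>j\<in>UNIV. (1 / \<tau> (pl j)) * (x $ j)\<^sup>2)"
      by (intro sum_mono mult_right_mono \<tau>) simp
    finally show ?thesis by (simp add: inner_vec_def power2_eq_square)
  qed
  have z: "z \<bullet> (\<chi> i. (1 / \<nu> i) *\<^sub>R z $ i) \<ge>
      (\<Sum>i\<in>UNIV. 2 * weighted_degree W i * (norm (z $ i))\<^sup>2) + \<delta> * (norm z)\<^sup>2"
  proof -
    have "(\<Sum>i\<in>UNIV. 2 * weighted_degree W i * (norm (z $ i))\<^sup>2) + \<delta> * (norm z)\<^sup>2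
       = (\<Sum>i\<in>UNIV. (2 * weighted_degree W i + \<delta>) * (norm (z $ i))\<^sup>2)"
      by (simp add: power2_norm_eq_inner inner_vec_def[of z] distrib_right sum.distrib sum_distrib_left)
    also have "\<dots> \<le> (\<Sum>i\<in>UNIV. (1 / \<nu> i) * (norm (z $ i))\<^sup>2)"
      by (intro sum_mono mult_right_mono \<nu>) simp
    finally show ?thesis by (simp add: inner_vec_def[of z] power2_norm_eq_inner)
  qed
  have l: "l \<bullet> (\<chi> i. (1 / \<sigma> i) *\<^sub>R l $ i) \<ge>
      (\<Sum>i\<in>UNIV. \<Sum>r\<in>UNIV. (\<Sum>j | pl j = i. \<bar>A $ r $ j\<bar>) * (l $ i $ r)\<^sup>2)
      + (\<Sum>i\<in>UNIV. 2 * weighted_degree W i * (norm (l $ i))\<^sup>2) + \<delta> * (norm l)\<^sup>2"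
  proof -
    have n: "(norm (l $ i))\<^sup>2 = (\<Sum>r\<in>UNIV. (l $ i $ r)\<^sup>2)" for i
      unfolding power2_norm_eq_inner by (simp add: inner_vec_def power2_eq_square)
    have nl: "(norm l)\<^sup>2 = (\<Sum>i\<in>UNIV. (norm (l $ i))\<^sup>2)"
      by (simp add: power2_norm_eq_inner inner_vec_def[of l])
    have "(\<Sum>i\<in>UNIV. \<Sum>r\<in>UNIV. (\<Sum>j | pl j = i. \<bar>A $ r $ j\<bar>) * (l $ i $ r)\<^sup>2)
        + (\<Sum>i\<in>UNIV. 2 * weighted_degree W i * (norm (l $ i))\<^sup>2) + \<delta> * (norm l)\<^sup>2
      = (\<Sum>i\<in>UNIV. \<Sum>r\<in>UNIV. ((\<Sum>j | pl j = i. \<bar>A $ r $ j\<bar>) + 2 * weighted_degree W i + \<delta>) * (l $ i $ r)\<^sup>2)"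
      unfolding nl n by (simp add: distrib_right sum.distrib sum_distrib_left)
    also have "\<dots> \<le> (\<Sum>i\<in>UNIV. \<Sum>r\<in>UNIV. (1 / \<sigma> i) * (l $ i $ r)\<^sup>2)"
      by (intro sum_mono mult_right_mono \<sigma>) simp
    also have "\<dots> = l \<bullet> (\<chi> i. (1 / \<sigma> i) *\<^sub>R l $ i)"
      by (simp add: inner_vec_def sum_distrib_left power2_eq_square)
    finally show ?thesis .
  qed
  have "u \<bullet> pd_metric pl A W \<tau> \<nu> \<sigma> u = x \<bullet> (\<chi> j. x $ j / \<tau> (pl j)) + z \<bullet> (\<chi> i. (1 / \<nu> i) *\<^sub>R z $ i)
      + l \<bullet> (\<chi> i. (1 / \<sigma> i) *\<^sub>R l $ i) + 2 * (stacked_constraint pl A x \<bullet> l) + 2 * (laplacian W z \<bullet> l)"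
    using stacked_adjoint_works[of pl A x l] laplacian_self_adjoint[OF sym, of z l]
    by (simp add: u pd_metric_def inner_prod_def inner_add_right inner_commute[of l])
  moreover have "(norm u)\<^sup>2 = (norm x)\<^sup>2 + (norm z)\<^sup>2 + (norm l)\<^sup>2"
    by (simp add: u power2_norm_eq_inner inner_prod_def)
  ultimately show ?thesis
    using x z l stacked_constraint_coupling[of pl A x l] laplacian_coupling[OF sym nn, of z l]
    by (simp add: distrib_left)
qed

lemma pd_smooth_diff:
  "pd_smooth F W bs (x, z, l) - pd_smooth F W bs (x', z', l')
     = (F x - F x', 0, laplacian W (l - l'))"
  by (simp add: pd_smooth_def linear_diff[OF linear_laplacian])

text \<open>
  The pseudo-gradient is \<open>\<eta> / \<theta>\<^sup>2\<close>-cocoercive and the Laplacian \<open>1 / (2 * d)\<close>-cocoercive; the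
  constant \<open>\<beta>\<close> is below both. The bound on \<open>\<beta>\<close> is written multiplicatively so that it also covers
  a graph without edges.
\<close>

lemma pd_smooth_cocoercive:
  fixes F :: "real^'n::finite \<Rightarrow> real^'n" and z l z' l' :: "(real^'m::finite)^'p::finite"
    and bs :: "'p \<Rightarrow> real^'m"
  assumes sym: "W = transpose W" and nn: "\<And>i j. 0 \<le> W $ i $ j"
    and deg: "\<And>i. weighted_degree W i \<le> d" "2 * \<beta> * d \<le> 1"
    and F: "strong_mono_lipschitz_at F \<eta> \<theta> x x'" and \<beta>: "0 \<le> \<beta>" "\<beta> * \<theta>\<^sup>2 \<le> \<eta>"
  defines "D \<equiv> pd_smooth F W bs (x, z, l) - pd_smooth F W bs (x', z', l')"
  shows "\<beta> * (norm D)\<^sup>2 \<le> D \<bullet> ((x, z, l) - (x', z', l'))"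
proof -
  have "\<beta> * (norm (F x - F x'))\<^sup>2 \<le> \<beta> * (\<theta> * norm (x - x'))\<^sup>2"
    using F \<beta> by (intro mult_left_mono power_mono) (auto simp: strong_mono_lipschitz_at_def)
  also have "\<dots> = \<beta> * \<theta>\<^sup>2 * (norm (x - x'))\<^sup>2" by (simp add: power_mult_distrib)
  also have "\<dots> \<le> \<eta> * (norm (x - x'))\<^sup>2" using \<beta> by (intro mult_right_mono) auto
  also have "\<dots> \<le> (F x - F x') \<bullet> (x - x')" using F by (simp add: strong_mono_lipschitz_at_def)
  finally have 1: "\<beta> * (norm (F x - F x'))\<^sup>2 \<le> (F x - F x') \<bullet> (x - x')" .
  let ?l = "l - l'"
  have "0 \<le> 2 * (laplacian W ?l \<bullet> ?l)"
    unfolding laplacian_inner[OF sym] using nn by (intro sum_nonneg) simp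
  then have pos: "0 \<le> laplacian W ?l \<bullet> ?l" by simp
  have "\<beta> * (norm (laplacian W ?l))\<^sup>2 \<le> \<beta> * (2 * d * (laplacian W ?l \<bullet> ?l))"
    using laplacian_cocoercive[OF sym nn deg(1)] \<beta> by (intro mult_left_mono)
  also have "\<dots> = (2 * \<beta> * d) * (laplacian W ?l \<bullet> ?l)" by simp
  also have "\<dots> \<le> 1 * (laplacian W ?l \<bullet> ?l)" using deg(2) pos by (intro mult_right_mono)
  finally have 2: "\<beta> * (norm (laplacian W ?l))\<^sup>2 \<le> laplacian W ?l \<bullet> ?l" by simp
  show ?thesis
    using 1 2 unfolding D_def pd_smooth_diff
    by (simp add: inner_prod_def power2_norm_eq_inner distrib_left)
qed

lemma pd_smooth_lipschitz:
  fixes F :: "real^'n::finite \<Rightarrow> real^'n" and z l z' l' :: "(real^'m::finite)^'p::finite"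
  assumes L: "\<And>y :: (real^'m)^'p. norm (laplacian W y) \<le> L * norm y" and L0: "0 \<le> L"
    and F: "strong_mono_lipschitz_at F \<eta> \<theta> x x'" and \<theta>: "0 \<le> \<theta>"
  shows "norm (pd_smooth F W bs (x, z, l) - pd_smooth F W bs (x', z', l'))
    \<le> (\<theta> + L) * norm ((x, z, l) - (x', z', l'))"
proof -
  have n: "norm a \<le> norm (a, b)" "norm b \<le> norm (a, b)"
    for a :: "'c::real_normed_vector" and b :: "'d::real_normed_vector"
    by (simp_all add: norm_Pair)
  have "norm (F x - F x', 0 :: (real^'m)^'p, laplacian W (l - l'))
      \<le> norm (F x - F x') + norm (laplacian W (l - l'))"
    using norm_Pair_le[of "F x - F x'" "(0 :: (real^'m)^'p, laplacian W (l - l'))"]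
    by (simp add: norm_Pair)
  also have "\<dots> \<le> \<theta> * norm (x - x') + L * norm (l - l')"
    using F L by (intro add_mono) (auto simp: strong_mono_lipschitz_at_def)
  also have "\<dots> \<le> \<theta> * norm (x - x', z - z', l - l') + L * norm (x - x', z - z', l - l')"
    using \<theta> L0 by (intro add_mono mult_left_mono n(1) order_trans[OF n(2) n(2)])
  finally show ?thesis unfolding pd_smooth_diff by (simp add: distrib_right)
qed

section \<open>Primal-dual zeros and KKT points\<close>

definition pd_zeros where
  "pd_zeros F pl \<Omega> A bs W = {s \<in> pd_set pl \<Omega>.
     \<forall>y\<in>pd_set pl \<Omega>. 0 \<le> (pd_smooth F W bs s + pd_skew pl A W s) \<bullet> (y - s)}"

text \<open>
  The second component of a zero enforces consensus. Summing the last component over the players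
  eliminates \<open>z\<close>, because Laplacians sum to zero, and recovers the condition on the shared
  constraint.
\<close>

lemma pd_zero_imp_consensus_KKT:
  fixes pl :: "'n::finite \<Rightarrow> 'p::finite" and A :: "real^'n^'m::finite"
  assumes W: "weighted_graph Nb W" "assumption3 Nb W"
    and \<Omega>: "\<And>i. \<Omega> i \<subseteq> player_space pl i"
    and diff: "\<And>i. (\<lambda>y. f i (with_block pl i y x)) differentiable (at x)"
    and b: "b = (\<Sum>i\<in>UNIV. bs i)"
    and zero: "(x, z, l) \<in> pd_zeros (pseudo_gradient pl f) pl \<Omega> A bs W"
  shows "\<exists>m. l = (\<chi> i. m) \<and> KKT pl f \<Omega> A b x m"
proof -
  define g where "g = stacked_constraint pl A x + laplacian W z - (\<chi> i. bs i)"
  have sym: "W = transpose W" using W(2) by (simp add: assumption3_def)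
  have x: "x \<in> joint_set pl \<Omega>" and l: "\<And>i. 0 \<le> l $ i"
    using zero by (auto simp: pd_zeros_def pd_set_def)
  have VI: "0 \<le> (pseudo_gradient pl f x - stacked_adjoint pl A l) \<bullet> (x' - x)
       - laplacian W l \<bullet> (z' - z) + (laplacian W l + g) \<bullet> (l' - l)"
    if "x' \<in> joint_set pl \<Omega>" "\<And>i. 0 \<le> l' $ i" for x' z' l'
  proof -
    have "(x', z', l') \<in> pd_set pl \<Omega>" using that by (simp add: pd_set_def)
    then have "0 \<le> (pd_smooth (pseudo_gradient pl f) W bs (x, z, l) + pd_skew pl A W (x, z, l))
        \<bullet> ((x', z', l') - (x, z, l))"
      using zero unfolding pd_zeros_def by blast
    moreover have "pd_smooth (pseudo_gradient pl f) W bs (x, z, l) + pd_skew pl A W (x, z, l)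
        = (pseudo_gradient pl f x - stacked_adjoint pl A l, - laplacian W l, laplacian W l + g)"
      by (simp add: pd_smooth_def pd_skew_def g_def)
    ultimately show ?thesis by (simp add: inner_prod_def)
  qed
  \<comment> \<open>The second component is unconstrained, so its inequality forces the Laplacian of \<open>l\<close> to vanish.\<close>
  have "0 \<le> - (laplacian W l \<bullet> laplacian W l)"
    using VI[OF x l, of "z + laplacian W l"] by simp
  then have Ll: "laplacian W l = 0" using inner_ge_zero by (metis inner_eq_zero_iff le_minus_iff minus_zero order_antisym)
  \<comment> \<open>By consensus any player's component serves as the common multiplier.\<close>
  define m where "m = l $ undefined"
  have lm: "l = (\<chi> i. m)"
    using laplacian_kernel[OF W Ll] by (simp add: m_def vec_eq_iff)
  have sum_g: "(\<Sum>i\<in>UNIV. g $ i) = A *v x - b"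
    by (simp add: g_def sum.distrib sum_subtractf sum_stacked_constraint sum_laplacian[OF sym] b)
  have "KKT pl f \<Omega> A b x m"
    unfolding KKT_iff[of \<Omega> pl f, OF \<Omega> diff]
  proof (intro conjI ballI allI impI x)
    show "0 \<le> m" using l by (simp add: m_def)
    show "0 \<le> (pseudo_gradient pl f x - transpose A *v m) \<bullet> (y - x)" if "y \<in> joint_set pl \<Omega>" for y
      using VI[OF that l, of z] by (simp add: lm stacked_adjoint_consensus)
    fix y :: "real^'m" assume y: "0 \<le> y"
    \<comment> \<open>Testing with a consensus vector sums the players' conditions, and the Laplacian of \<open>z\<close> sums to zero.\<close>
    have "0 \<le> g \<bullet> ((\<chi> i. y) - l)" using VI[OF x, of "\<chi> i. y" z] y Ll by simp
    also have "\<dots> = (A *v x - b) \<bullet> (y - m)"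
      by (simp add: inner_vec_def[of g] lm inner_sum_left[symmetric] sum_g)
    finally show "0 \<le> (A *v x - b) \<bullet> (y - m)" .
  qed
  with lm show ?thesis by blast
qed

text \<open>
  The players' individual residuals need not satisfy the complementarity conditions one by one, only
  their sum does. The variable \<open>z\<close> redistributes them, which is possible since the differences from
  the average sum to zero.
\<close>

lemma KKT_imp_pd_zero:
  fixes pl :: "'n::finite \<Rightarrow> 'p::finite" and A :: "real^'n^'m::finite"
  assumes W: "weighted_graph Nb W" "assumption3 Nb W"
    and \<Omega>: "\<And>i. \<Omega> i \<subseteq> player_space pl i"
    and diff: "\<And>i. (\<lambda>y. f i (with_block pl i y x)) differentiable (at x)"
    and b: "b = (\<Sum>i\<in>UNIV. bs i)"
    and KKT: "KKT pl f \<Omega> A b x m"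
  shows "\<exists>z. (x, z, \<chi> i. m) \<in> pd_zeros (pseudo_gradient pl f) pl \<Omega> A bs W"
proof -
  \<comment> \<open>The aggregate residual is shared equally; \<open>z\<close> has to make up each player's deviation from it.\<close>
  define v where "v = (1 / real CARD('p)) *\<^sub>R (A *v x - b)"
  have "CARD('p) > 0" by simp
  then have "(\<Sum>i\<in>(UNIV :: 'p set). v) = A *v x - b"
    by (simp add: v_def sum_constant_scaleR del: sum_constant)
  then have "(\<Sum>i\<in>UNIV. ((\<chi> i. v + bs i) - stacked_constraint pl A x) $ i) = 0"
    by (simp add: sum.distrib sum_subtractf sum_stacked_constraint b)
  then obtain z where z: "laplacian W z = (\<chi> i. v + bs i) - stacked_constraint pl A x"
    using laplacian_solvable[OF W] by blast
  have L0: "laplacian W (\<chi> i. m) = 0" by (simp add: laplacian_def vec_eq_iff)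
  have k: "x \<in> joint_set pl \<Omega>" "0 \<le> m"
      "\<And>y. y \<in> joint_set pl \<Omega> \<Longrightarrow> 0 \<le> (pseudo_gradient pl f x - transpose A *v m) \<bullet> (y - x)"
      "\<And>y. 0 \<le> y \<Longrightarrow> 0 \<le> (A *v x - b) \<bullet> (y - m)"
    using KKT unfolding KKT_iff[of \<Omega> pl f, OF \<Omega> diff] by auto
  have "0 \<le> (pd_smooth (pseudo_gradient pl f) W bs (x, z, \<chi> i. m) + pd_skew pl A W (x, z, \<chi> i. m))
      \<bullet> (y - (x, z, \<chi> i. m))" if y: "y \<in> pd_set pl \<Omega>" for y
  proof -
    obtain x' z' l' where y': "y = (x', z', l')" by (cases y) auto
    have x': "x' \<in> joint_set pl \<Omega>" and l': "\<And>i. 0 \<le> l' $ i"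
      using y by (auto simp: pd_set_def y')
    have "pd_smooth (pseudo_gradient pl f) W bs (x, z, \<chi> i. m) + pd_skew pl A W (x, z, \<chi> i. m)
        = (pseudo_gradient pl f x - transpose A *v m, 0, \<chi> i. v)"
      by (simp add: pd_smooth_def pd_skew_def L0 z stacked_adjoint_consensus) (simp add: vec_eq_iff)
    moreover have "0 \<le> (\<chi> i. v) \<bullet> (l' - (\<chi> i. m))"
      unfolding inner_vec_def[of "\<chi> i. v"] using k(4)[OF l'] by (intro sum_nonneg) (simp add: v_def)
    ultimately show ?thesis using k(3)[OF x'] by (simp add: y' inner_prod_def)
  qed
  moreover have "(x, z, \<chi> i. m) \<in> pd_set pl \<Omega>" using k(1,2) by (simp add: pd_set_def)
  ultimately show ?thesis unfolding pd_zeros_def by blast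
qed

section \<open>The iteration as a forward-backward step\<close>

lemma laplacian_component:
  assumes "weighted_graph Nb W"
  shows "laplacian W y $ i = (\<Sum>j\<in>Nb i. (W $ i $ j) *\<^sub>R (y $ i - y $ j))"
  unfolding laplacian_def vec_lambda_beta
  by (rule sum.mono_neutral_right) (use assms in \<open>auto simp: weighted_graph_def\<close>)

text \<open>
  The obtuse angle property of the projection, normalised by the step size.
\<close>

lemma projection_VI:
  assumes C: "convex C" "closed C" "y \<in> C" and t: "0 < t"
    and v: "v = closest_point C (w - t *\<^sub>R g)"
  shows "0 \<le> ((1 / t) *\<^sub>R (v - w) + g) \<bullet> (y - v)"
proof -
  have "(w - t *\<^sub>R g - v) \<bullet> (y - v) \<le> 0"
    using closest_point_dot[OF C, of "w - t *\<^sub>R g"] v by simp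
  also have "w - t *\<^sub>R g - v = (- t) *\<^sub>R ((1 / t) *\<^sub>R (v - w) + g)"
    using t by (simp add: algebra_simps)
  finally show ?thesis using t by (simp add: zero_le_mult_iff)
qed

text \<open>
  The three updates are exactly one backward step in the metric \<open>pd_metric\<close>: the doubled terms
  \<open>2 * A\<^sub>i * x\<close> and \<open>2 * L * z\<close> in the multiplier update arise as one copy from the metric and one
  from the skew coupling, both evaluated at the new iterate.
\<close>

lemma inertial_iteration_pd_step:
  fixes pl :: "'n::finite \<Rightarrow> 'p::finite" and A :: "real^'n^'m::finite"
  assumes graph: "weighted_graph Nb W"
    and \<Omega>: "\<And>i. \<Omega> i \<subseteq> player_space pl i" "\<And>i. closed (\<Omega> i)" "\<And>i. convex (\<Omega> i)"
    and nonempty: "joint_set pl \<Omega> \<noteq> {}"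
    and diff: "\<And>i x. (\<lambda>y. f i (with_block pl i y x)) differentiable (at x)"
    and pos: "\<And>i. \<tau> i > 0" "\<And>i. \<nu> i > 0" "\<And>i. \<sigma> i > 0"
    and iter: "inertial_iteration pl f \<Omega> A bs Nb W \<tau> \<nu> \<sigma> \<alpha> x z l" and k: "1 \<le> k"
    and u: "u = (\<lambda>k. (x k, (\<chi> i. z k i), (\<chi> i. l k i)))"
  shows "u (k + 1) \<in> pd_set pl \<Omega>"
    and "y \<in> pd_set pl \<Omega> \<Longrightarrow>
      0 \<le> (pd_metric pl A W \<tau> \<nu> \<sigma> (u (k + 1) - extrapolate \<alpha> u k)
         + pd_smooth (pseudo_gradient pl f) W bs (extrapolate \<alpha> u k)
         + pd_skew pl A W (u (k + 1))) \<bullet> (y - u (k + 1))"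
proof -
  define xt where "xt = extrapolate \<alpha> x k"
  define zt :: "(real^'m)^'p" where "zt = (\<chi> i. extrapolate \<alpha> (\<lambda>k. z k i) k)"
  define lt :: "(real^'m)^'p" where "lt = (\<chi> i. extrapolate \<alpha> (\<lambda>k. l k i) k)"
  define xn where "xn = x (k + 1)"
  define zn :: "(real^'m)^'p" where "zn = (\<chi> i. z (k + 1) i)"
  define ln :: "(real^'m)^'p" where "ln = (\<chi> i. l (k + 1) i)"
  have un: "u (k + 1) = (xn, zn, ln)" by (simp add: u xn_def zn_def ln_def)
  have ut: "extrapolate \<alpha> u k = (xt, zt, lt)"
    by (simp add: u extrapolate_def xt_def zt_def lt_def vec_eq_iff)
  define gx where "gx i = partial_gradient pl i (f i) xt - transpose (column_block pl i A) *v (lt $ i)" for i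
  define gl where "gl = 2 *\<^sub>R stacked_constraint pl A xn - stacked_constraint pl A xt - (\<chi> i. bs i)
      + laplacian W lt + 2 *\<^sub>R laplacian W zn - laplacian W zt"
  have step: "block pl i xn = closest_point (\<Omega> i) (block pl i xt - \<tau> i *\<^sub>R gx i)"
    "zn $ i = zt $ i + \<nu> i *\<^sub>R laplacian W lt $ i"
    "ln $ i = closest_point nonneg_orthant (lt $ i - \<sigma> i *\<^sub>R gl $ i)" for i
    using iter[unfolded inertial_iteration_def, rule_format, OF k, of i]
    by (simp_all add: Let_def laplacian_component[OF graph] xt_def zt_def lt_def xn_def zn_def ln_def gx_def
        gl_def stacked_constraint_def column_block_mult_block)
  have ne: "\<Omega> i \<noteq> {}" for i using nonempty by (auto simp: joint_set_def)
  have xn: "xn \<in> joint_set pl \<Omega>"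
    unfolding joint_set_def using closest_point_in_set[OF \<Omega>(2) ne] by (simp add: step(1))
  have "(0 :: real^'m) \<in> nonneg_orthant" by (simp add: nonneg_orthant_def)
  then have "ln $ i \<in> nonneg_orthant" for i
    unfolding step(3) using closest_point_in_set[OF closed_nonneg_orthant] by blast
  then have ln: "0 \<le> ln $ i" for i by (simp add: nonneg_orthant_def)
  show "u (k + 1) \<in> pd_set pl \<Omega>" unfolding un using xn ln by (simp add: pd_set_def)
  define hx where "hx = (\<chi> j. (xn - xt) $ j / \<tau> (pl j)) + pseudo_gradient pl f xt - stacked_adjoint pl A lt"
  define hl where "hl = (\<chi> i. (1 / \<sigma> i) *\<^sub>R (ln - lt) $ i) + gl"
  have hx: "block pl i hx = (1 / \<tau> i) *\<^sub>R (block pl i xn - block pl i xt) + gx i" for i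
  proof -
    have "block pl i (\<chi> j. (xn - xt) $ j / \<tau> (pl j)) = (1 / \<tau> i) *\<^sub>R (block pl i xn - block pl i xt)"
      by (auto simp: block_def vec_eq_iff)
    then show ?thesis
      by (simp add: hx_def gx_def linear_add[OF linear_block] linear_diff[OF linear_block]
          block_pseudo_gradient[of f, OF diff] block_stacked_adjoint)
  qed
  have op: "pd_metric pl A W \<tau> \<nu> \<sigma> ((xn, zn, ln) - (xt, zt, lt))
      + pd_smooth (pseudo_gradient pl f) W bs (xt, zt, lt) + pd_skew pl A W (xn, zn, ln) = (hx, 0, hl)"
  proof -
    \<comment> \<open>The update of \<open>z\<close> cancels the second component exactly.\<close>
    have "(1 / \<nu> i) *\<^sub>R (zn - zt) $ i = laplacian W lt $ i" for i
      using pos(2)[of i] by (simp add: step(2))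
    then have "(\<chi> i. (1 / \<nu> i) *\<^sub>R (zn - zt) $ i) = laplacian W lt" by (simp add: vec_eq_iff)
    then show ?thesis
      by (simp add: pd_metric_def pd_smooth_def pd_skew_def hx_def hl_def gl_def
          linear_diff[OF linear_stacked_adjoint] linear_diff[OF linear_laplacian]
          linear_diff[OF linear_stacked_constraint] scaleR_2)
  qed
  assume "y \<in> pd_set pl \<Omega>"
  then obtain x' z' l' where y: "y = (x', z', l')" "x' \<in> joint_set pl \<Omega>" "\<And>i. 0 \<le> l' $ i"
    by (auto simp: pd_set_def)
  have "0 \<le> block pl i hx \<bullet> (y - block pl i xn)" if "y \<in> \<Omega> i" for i y
    unfolding hx by (rule projection_VI[OF \<Omega>(3,2) that pos(1) step(1)])
  then have "0 \<le> hx \<bullet> (x' - xn)"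
    using joint_VI_iff_blockwise[of \<Omega>, OF \<Omega>(1) xn, of hx] y(2) by blast
  moreover have "0 \<le> hl $ i \<bullet> (l' $ i - ln $ i)" for i
    using projection_VI[OF convex_nonneg_orthant closed_nonneg_orthant _ pos(3) step(3), of "l' $ i" i] y(3)
    by (simp add: hl_def nonneg_orthant_def)
  then have "0 \<le> hl \<bullet> (l' - ln)" unfolding inner_vec_def[of hl] by (simp add: sum_nonneg)
  ultimately show "0 \<le> (pd_metric pl A W \<tau> \<nu> \<sigma> (u (k + 1) - extrapolate \<alpha> u k)
      + pd_smooth (pseudo_gradient pl f) W bs (extrapolate \<alpha> u k)
      + pd_skew pl A W (u (k + 1))) \<bullet> (y - u (k + 1))"
    unfolding un ut op y(1) by (simp add: inner_prod_def)
qed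

lemma closed_pd_set:
  assumes "\<And>i. closed (\<Omega> i)"
  shows "closed (pd_set pl \<Omega> :: ('n::finite, 'm::finite, 'p::finite) pd_point set)"
proof -
  have "{l :: (real^'m)^'p. \<forall>i. 0 \<le> l $ i} = (\<Inter>i. \<Inter>r. {l. 0 \<le> l $ i $ r})"
    by (auto simp: less_eq_vec_def)
  moreover have "closed (\<Inter>i. \<Inter>r. {l :: (real^'m)^'p. 0 \<le> l $ i $ r})"
    by (intro closed_INT ballI closed_Collect_le continuous_intros)
  ultimately show ?thesis
    unfolding pd_set_def by (intro closed_Times closed_joint_set assms closed_UNIV) simp
qed

lemma step_size_bound:
  fixes t M :: real assumes "0 < t" "t \<le> 1 / M" shows "M \<le> 1 / t"
proof -
  have "0 < 1 / M" using assms by linarith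
  then have "0 < M" by (simp only: zero_less_divide_1_iff)
  then show ?thesis using assms by (simp add: field_simps)
qed

section \<open>Convergence to the variational equilibrium\<close>

theorem theorem6p3:
  fixes pl :: "'n::finite \<Rightarrow> 'p::finite"
    and f :: "'p \<Rightarrow> real^'n \<Rightarrow> real"
    and \<Omega> :: "'p \<Rightarrow> (real^'n) set"
    and A :: "real^'n^'m::finite"
    and bs :: "'p \<Rightarrow> real^'m"
    and b :: "real^'m"
    and Nb :: "'p \<Rightarrow> 'p set"
    and W :: "real^'p^'p"
    and \<eta> \<theta> \<beta> \<delta> \<alpha> \<epsilon> dmax :: real
    and \<tau> \<nu> \<sigma> :: "'p \<Rightarrow> real"
    and x :: "nat \<Rightarrow> real^'n"
    and z l :: "nat \<Rightarrow> 'p \<Rightarrow> real^'m"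
  assumes blocks: "surj pl"
    and private_sets: "\<And>i. \<Omega> i \<subseteq> player_space pl i"
    and b_def: "b = (\<Sum>i\<in>UNIV. bs i)"
    and graph: "weighted_graph Nb W"
    and A1: "assumption1 pl f \<Omega> A b"
    and A2: "assumption2 pl f \<Omega> \<eta> \<theta>"
    and A3: "assumption3 Nb W"
    and dmax_def: "dmax = Max (range (weighted_degree W))"
    and beta_pos: "0 < \<beta>"
    and beta_le: "\<beta> \<le> (if dmax = 0 then \<eta> / \<theta>\<^sup>2 else min (1 / (2 * dmax)) (\<eta> / \<theta>\<^sup>2))"
    and eps: "0 < \<epsilon>" "\<epsilon> < 1"
    and delta: "\<delta> > 1 / (2 * \<beta>)"
    and alpha: "0 < \<alpha>" "\<alpha> < 1"
    and inertia: "2 * \<beta> * \<delta> * (1 - 3 * \<alpha> - \<epsilon>) \<ge> (1 - \<alpha>)\<^sup>2"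
    and steps_pos: "\<And>i. \<tau> i > 0" "\<And>i. \<nu> i > 0" "\<And>i. \<sigma> i > 0"
    and tau: "\<And>i. \<tau> i \<le> 1 / (Max {(\<Sum>k\<in>UNIV. \<bar>transpose A $ j $ k\<bar>) | j. pl j = i} + \<delta>)"
    and nu: "\<And>i. \<nu> i \<le> 1 / (2 * weighted_degree W i + \<delta>)"
    and sigma: "\<And>i. \<sigma> i \<le> 1 / (Max (range (\<lambda>j. \<Sum>k | pl k = i. \<bar>A $ j $ k\<bar>))
                                + 2 * weighted_degree W i + \<delta>)"
    and iteration: "inertial_iteration pl f \<Omega> A bs Nb W \<tau> \<nu> \<sigma> \<alpha> x z l"
    and extrapolated: "\<And>k y. k \<ge> 1 \<Longrightarrow> y \<in> joint_set pl \<Omega> \<Longrightarrow>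
          strong_mono_lipschitz_at (pseudo_gradient pl f) \<eta> \<theta> (extrapolate \<alpha> x k) y"
  shows "\<exists>xs ls. (\<forall>y. variational_GNE pl f \<Omega> A b y \<longleftrightarrow> y = xs) \<and>
           KKT pl f \<Omega> A b xs ls \<and>
           (\<forall>i. (\<lambda>k. block pl i (x k)) \<longlonglongrightarrow> block pl i xs) \<and>
           (\<forall>i. (\<lambda>k. l k i) \<longlonglongrightarrow> ls)"
proof -
  let ?F = "pseudo_gradient pl f" and ?X = "feasible_set pl \<Omega> A b"
  have diff: "(\<lambda>y. f i (with_block pl i y x)) differentiable (at x)" for i x
    using A1 by (auto simp: assumption1_def differentiable_on_def)
  have \<Omega>: "\<And>i. closed (\<Omega> i)" "\<And>i. convex (\<Omega> i)" and int: "interior ?X \<noteq> {}"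
    using A1 by (auto simp: assumption1_def)
  have \<eta>\<theta>: "0 < \<eta>" "0 < \<theta>"
    and F: "\<And>x y. x \<in> joint_set pl \<Omega> \<Longrightarrow> y \<in> joint_set pl \<Omega> \<Longrightarrow> strong_mono_lipschitz_at ?F \<eta> \<theta> x y"
    using A2 by (auto simp: assumption2_def)
  have sym: "W = transpose W" using A3 by (simp add: assumption3_def)
  have nn: "0 \<le> W $ i $ j" for i j
    using graph by (metis order.refl order_less_imp_le weighted_graph_def)
  have X: "?X \<noteq> {}" "?X \<subseteq> joint_set pl \<Omega>"
    using int interior_subset[of ?X] by (auto simp: feasible_set_def)
  have constraint: "{x. b \<le> A *v x} = (\<Inter>r. {x. b $ r \<le> row r A \<bullet> x})"
    by (auto simp: less_eq_vec_def matrix_vector_mul_component row_def vec_nth_inverse)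
  have closedX: "closed ?X"
    unfolding feasible_set_def constraint
    by (intro closed_Int closed_joint_set \<Omega> closed_INT ballI closed_Collect_le continuous_intros)
  have convexX: "convex ?X"
    unfolding feasible_set_def constraint
    by (intro convex_Int convex_joint_set \<Omega> convex_INT) (simp add: convex_halfspace_ge)
  have FX: "strong_mono_lipschitz_at ?F \<eta> \<theta> x y" if "x \<in> ?X" "y \<in> ?X" for x y
    using F X(2) that by blast
  \<comment> \<open>A primal-dual zero is needed first: distances to it are what the convergence argument measures.\<close>
  obtain xs where xs: "VI_solution ?F ?X xs"
    using VI_solution_exists[OF closedX convexX X(1) FX \<eta>\<theta>] by blast
  obtain m where m: "KKT pl f \<Omega> A b xs m"
    using VI_solution_imp_KKT[of \<Omega> pl f, OF private_sets \<Omega>(2) diff int xs] by blast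
  obtain zs where zero: "(xs, zs, \<chi> i. m) \<in> pd_zeros ?F pl \<Omega> A bs W"
    using KKT_imp_pd_zero[of Nb W \<Omega> pl f, OF graph A3 private_sets diff b_def m] by blast

  have deg: "weighted_degree W i \<le> dmax" for i
    unfolding dmax_def by (intro Max_ge) auto
  have "0 \<le> weighted_degree W undefined" using nn by (simp add: weighted_degree_def sum_nonneg)
  with deg[of undefined] have d0: "0 \<le> dmax" by linarith
  \<comment> \<open>The two parts of the bound on \<open>\<beta>\<close> serve the Laplacian and the pseudo-gradient, respectively.\<close>
  have d\<beta>: "2 * \<beta> * dmax \<le> 1"
    using beta_le d0 by (cases "dmax = 0") (auto simp: field_simps)
  have \<beta>\<theta>: "\<beta> * \<theta>\<^sup>2 \<le> \<eta>"
    using beta_le \<eta>\<theta> by (auto simp: field_simps split: if_splits)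
  have \<tau>_step: "(\<Sum>r\<in>UNIV. \<bar>A $ r $ j\<bar>) + \<delta> \<le> 1 / \<tau> (pl j)" for j
  proof -
    have "(\<Sum>k\<in>UNIV. \<bar>transpose A $ j $ k\<bar>) \<le> Max {(\<Sum>k\<in>UNIV. \<bar>transpose A $ j' $ k\<bar>) | j'. pl j' = pl j}"
      by (intro Max_ge) auto
    then show ?thesis
      using step_size_bound[OF steps_pos(1) tau, of "pl j"] by (simp add: transpose_def)
  qed
  have \<sigma>_step: "(\<Sum>j | pl j = i. \<bar>A $ r $ j\<bar>) + 2 * weighted_degree W i + \<delta> \<le> 1 / \<sigma> i" for i r
  proof -
    have "(\<Sum>j | pl j = i. \<bar>A $ r $ j\<bar>) \<le> Max (range (\<lambda>j. \<Sum>k | pl k = i. \<bar>A $ j $ k\<bar>))"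
      by (intro Max_ge) auto
    then show ?thesis using step_size_bound[OF steps_pos(3) sigma, of i] by linarith
  qed
  obtain L where L: "0 < L" "\<And>y :: (real^'m)^'p. norm (laplacian W y) \<le> L * norm y"
    using linear_bounded_pos[OF linear_laplacian[of W]] by blast

  define u :: "nat \<Rightarrow> ('n, 'm, 'p) pd_point" where "u = (\<lambda>k. (x k, (\<chi> i. z k i), (\<chi> i. l k i)))"
  have ut: "\<exists>zt lt. extrapolate \<alpha> u k = (extrapolate \<alpha> x k, zt, lt)" for k
    by (simp add: u_def extrapolate_def)
  have "joint_set pl \<Omega> \<noteq> {}" using X by blast
  note step = inertial_iteration_pd_step[of Nb W \<Omega> pl f, OF graph private_sets \<Omega> this diff steps_pos iteration _ u_def]
  have "\<exists>s\<in>pd_zeros ?F pl \<Omega> A bs W. u \<longlonglongrightarrow> s"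
    unfolding pd_zeros_def
  proof (rule inertial_forward_backward_convergence[OF closed_pd_set[of \<Omega>, OF \<Omega>(1)] linear_pd_skew _
        linear_pd_metric pd_metric_self_adjoint[OF sym]
        pd_metric_elliptic[OF sym nn \<tau>_step step_size_bound[OF steps_pos(2) nu] \<sigma>_step]
        beta_pos eps(1) delta _ alpha(2) inertia step])
    show "0 \<le> pd_skew pl A W v \<bullet> v" for v by (simp add: pd_skew_inner[OF sym])
    show "0 \<le> \<alpha>" using alpha by simp
    show "{s \<in> pd_set pl \<Omega>. \<forall>y\<in>pd_set pl \<Omega>. 0 \<le> (pd_smooth ?F W bs s + pd_skew pl A W s) \<bullet> (y - s)} \<noteq> {}"
      using zero unfolding pd_zeros_def by blast
  next
    fix k :: nat and s :: "('n, 'm, 'p) pd_point" assume k: "1 \<le> k"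
      and "s \<in> {s \<in> pd_set pl \<Omega>. \<forall>y\<in>pd_set pl \<Omega>. 0 \<le> (pd_smooth ?F W bs s + pd_skew pl A W s) \<bullet> (y - s)}"
    then obtain x' z' l' where s: "s = (x', z', l')" "x' \<in> joint_set pl \<Omega>"
      by (cases s) (auto simp: pd_set_def)
    obtain zt lt where e: "extrapolate \<alpha> u k = (extrapolate \<alpha> x k, zt, lt)" using ut by blast
    show "\<beta> * (norm (pd_smooth ?F W bs (extrapolate \<alpha> u k) - pd_smooth ?F W bs s))\<^sup>2
        \<le> (pd_smooth ?F W bs (extrapolate \<alpha> u k) - pd_smooth ?F W bs s) \<bullet> (extrapolate \<alpha> u k - s)"
      unfolding s(1) e
      using pd_smooth_cocoercive[OF sym nn deg d\<beta> extrapolated[OF k s(2)] _ \<beta>\<theta>] beta_pos by simp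
  next
    fix k :: nat and s :: "('n, 'm, 'p) pd_point" assume k: "1 \<le> k" and "s \<in> pd_set pl \<Omega>"
    then obtain x' z' l' where s: "s = (x', z', l')" "x' \<in> joint_set pl \<Omega>"
      by (cases s) (auto simp: pd_set_def)
    obtain zt lt where e: "extrapolate \<alpha> u k = (extrapolate \<alpha> x k, zt, lt)" using ut by blast
    show "norm (pd_smooth ?F W bs (extrapolate \<alpha> u k) - pd_smooth ?F W bs s)
        \<le> (\<theta> + L) * norm (extrapolate \<alpha> u k - s)"
      unfolding s(1) e
      using pd_smooth_lipschitz[OF L(2) _ extrapolated[OF k s(2)]] L(1) \<eta>\<theta> by simp
  qed
  then obtain xl zl ll where lim: "u \<longlonglongrightarrow> (xl, zl, ll)" "(xl, zl, ll) \<in> pd_zeros ?F pl \<Omega> A bs W"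
    by auto
  obtain ls where ls: "ll = (\<chi> i. ls)" "KKT pl f \<Omega> A b xl ls"
    using pd_zero_imp_consensus_KKT[of Nb W \<Omega> pl f, OF graph A3 private_sets diff b_def lim(2)] by blast
  have VI: "VI_solution ?F ?X xl"
    by (rule KKT_imp_VI_solution[of \<Omega> pl f, OF private_sets diff ls(2)])
  have x_lim: "x \<longlonglongrightarrow> xl" using tendsto_fst[OF lim(1)] by (simp add: u_def)
  have l_lim: "(\<lambda>k. \<chi> i. l k i) \<longlonglongrightarrow> (\<chi> i. ls)"
    using tendsto_snd[OF tendsto_snd[OF lim(1)]] by (simp add: u_def ls(1))
  show ?thesis
  proof (intro exI[of _ xl] exI[of _ ls] conjI allI)
    show "variational_GNE pl f \<Omega> A b y \<longleftrightarrow> y = xl" for y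
      unfolding variational_GNE_def using VI VI_solution_unique[OF _ VI FX \<eta>\<theta>(1)] by blast
    show "KKT pl f \<Omega> A b xl ls" by (rule ls(2))
    show "(\<lambda>k. block pl i (x k)) \<longlonglongrightarrow> block pl i xl" for i
      using bounded_linear.tendsto[OF linear_block[unfolded linear_conv_bounded_linear] x_lim] .
    show "(\<lambda>k. l k i) \<longlonglongrightarrow> ls" for i
      using tendsto_vec_nth[OF l_lim, of i] by simp
  qed
qed

end
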